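(* Let $n\ge 3$ be an integer. There exists a constant $c_n>0$, depending only on $n$, such that for every convex $n$-gon $P\subset\mathbb{R}^2$, $$c_n\,\delta(P)\ \ge\ \sigma_r^2(P)+|P|\,\sigma_a^2(P).$$ Moreover, the exponent $1$ on the deficit $\delta(P)$ is sharp, in the following sense: for no $p>1$ and no $C>0$ does the inequality $\sigma_r^2(P)+|P|\,\sigma_a^2(P)\le C\,\delta(P)^p$ hold for all convex $n$-gons $P$ normalized so that their radii satisfy $\sum_{i=1}^n r_i=n$.
   Context: Let $P\subset\mathbb{R}^2$ be a convex $n$-gon with vertices $A_1,\dots,A_n$ listed in cyclic order along its boundary, with indices taken modulo $n$. $|P|$ denotes the area of $P$ and $L(P)=\sum_{i=1}^n|A_iA_{i+1}|$ its perimeter. The polygonal isoperimetric deficit is $$\delta(P):=L^2(P)-4n\tan\frac{\pi}{n}\,|P|,$$ where $L^2(P)=(L(P))^2$; by the classical polygonal isoperimetric inequality $\delta(P)\ge 0$. Let $O=\frac1n\sum_{i=1}^n A_i$ be the barycenter of the vertices. The radii of $P$ are $r_i:=|OA_i|$, $i=1,\dots,n$. The central angles of $P$ are $x_i$, $i=1,\dots,n$, where $x_i$ is the angle between the vectors $\overrightarrow{OA_i}$ and $\overrightarrow{OA_{i+1}}$ (for a convex polygon, $\sum_{i=1}^n x_i=2\pi$). The variances of the radii and of the central angles are $$\sigma_r^2(P):=\frac1n\sum_{i=1}^n r_i^2-\frac1{n^2}\Big(\sum_{i=1}^n r_i\Big)^2,\qquad \sigma_a^2(P):=\frac1n\sum_{i=1}^n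 x_i^2-\frac1{n^2}\Big(\sum_{i=1}^n x_i\Big)^2.$$ *)

theory Defs
  imports "HOL-Analysis.Analysis"
begin

text \<open>
  A family of \<open>n\<close> cyclically indexed objects is a function on \<open>nat\<close> used only at the
  arguments \<open>0, \<dots>, n - 1\<close>; the successor of index \<open>i\<close> is \<open>Suc i mod n\<close>.

  Requiring consecutive vertices to span an edge (a one-dimensional face) of \<open>P\<close> says that the
  vertices are listed in cyclic order along the boundary; both orientations are allowed. The
  vertices of \<open>P\<close> are its extreme points, so no interior angle equals \<open>pi\<close>, and as there are at
  least three of them, \<open>P\<close> is two-dimensional.
\<close>

definition convex_ngon :: "nat \<Rightarrow> (nat \<Rightarrow> real^2) \<Rightarrow> (real^2) set \<Rightarrow> bool" where
  "convex_ngon n A P \<longleftrightarrow>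
     3 \<le> n \<and> polytope P \<and>
     bij_betw A {..<n} {v. v extreme_point_of P} \<and>
     (\<forall>i<n. closed_segment (A i) (A (Suc i mod n)) edge_of P)"

definition area :: "(real^2) set \<Rightarrow> real" where
  "area P = measure lebesgue P"

definition perimeter :: "nat \<Rightarrow> (nat \<Rightarrow> real^2) \<Rightarrow> real" where
  "perimeter n A = (\<Sum>i<n. dist (A i) (A (Suc i mod n)))"

definition deficit :: "nat \<Rightarrow> (nat \<Rightarrow> real^2) \<Rightarrow> (real^2) set \<Rightarrow> real" where
  "deficit n A P = (perimeter n A)\<^sup>2 - 4 * real n * tan (pi / real n) * area P"

definition vertex_barycenter :: "nat \<Rightarrow> (nat \<Rightarrow> real^2) \<Rightarrow> real^2" where
  "vertex_barycenter n A = (1 / real n) *\<^sub>R (\<Sum>i<n. A i)"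

definition radius :: "nat \<Rightarrow> (nat \<Rightarrow> real^2) \<Rightarrow> nat \<Rightarrow> real" where
  "radius n A i = dist (vertex_barycenter n A) (A i)"

text \<open>
  The unoriented angle in \<open>[0, pi]\<close> between nonzero vectors. It is only applied to vectors from
  the barycenter to the vertices of a convex polygon, which are nonzero because the barycenter
  is an interior point.
\<close>

definition vec_angle :: "real^2 \<Rightarrow> real^2 \<Rightarrow> real" where
  "vec_angle u v = arccos ((u \<bullet> v) / (norm u * norm v))"

definition central_angle :: "nat \<Rightarrow> (nat \<Rightarrow> real^2) \<Rightarrow> nat \<Rightarrow> real" where
  "central_angle n A i =
     vec_angle (A i - vertex_barycenter n A) (A (Suc i mod n) - vertex_barycenter n A)"

definition family_variance :: "nat \<Rightarrow> (nat \<Rightarrow> real) \<Rightarrow> real" where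
  "family_variance n f = (1 / real n) * (\<Sum>i<n. (f i)\<^sup>2) - (1 / (real n)\<^sup>2) * (\<Sum>i<n. f i)\<^sup>2"

definition radii_variance :: "nat \<Rightarrow> (nat \<Rightarrow> real^2) \<Rightarrow> real" where
  "radii_variance n A = family_variance n (radius n A)"

definition angle_variance :: "nat \<Rightarrow> (nat \<Rightarrow> real^2) \<Rightarrow> real" where
  "angle_variance n A = family_variance n (central_angle n A)"

end

theory Submission
  imports Defs
begin

text \<open>
  Put the barycenter of the vertices at the origin of the complex plane, let \<open>z k\<close> be the
  vertices, \<open>L\<close> the perimeter, \<open>E\<close> the sum of the squared sides and \<open>A\<close> the signed area given
  by the shoelace formula. Everything rests on two quantities: the form
  \<open>Q = E - 4 tan(pi/n) A\<close>, which is quadratic in the vertices, and the spread \<open>D = n E - L^2\<close>,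
  which is \<open>n^2\<close> times the variance of the side lengths. The deficit is \<open>n Q - D\<close>.

  The discrete Fourier transform diagonalizes \<open>Q\<close>. The mode \<open>m\<close> has weight
  \<open>4 sin(pi m/n) sin(pi (m-1)/n) / cos(pi/n)\<close>, which vanishes for \<open>m = 0\<close> (translations) and
  \<open>m = 1\<close> (regular polygons) and is positive otherwise. So \<open>Q\<close> bounds the squared distance of
  the polygon to a regular one (\<open>energy_excess_coercive\<close>), and stability would be immediate if
  \<open>D\<close> could be absorbed. That is the main point of the proof: for some \<open>k > 0\<close> the deficit is
  at least \<open>k D\<close> for all closed polygons, convex or not (\<open>side_spread_le_deficit\<close>). It implies
  \<open>n Q \<le> (1 + 1/k) (deficit)\<close>.

  For this bound let \<open>g = (deficit) - k D\<close> and suppose that \<open>g < 0\<close> for some polygon. As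
  \<open>g = n Q - (1 + k) D\<close> and \<open>Q \<ge> 0\<close>, the sides differ noticeably, hence so do two adjacent
  sides. Moving their common vertex on the ellipse of constant length sum until the two sides
  are equal keeps \<open>L\<close>, decreases \<open>D\<close> and, unless the angle at the vertex is almost straight,
  gains enough area to multiply \<open>g\<close> by a constant factor larger than one. If the angle is
  almost straight, deleting the vertex hardly changes the area, and polygons with \<open>n - 1\<close> sides
  enclose strictly less area in proportion to \<open>L^2\<close>, which already yields \<open>g \<ge> 0\<close>. So the
  move could be repeated forever with \<open>L\<close> fixed, although \<open>g\<close> is bounded below by a
  multiple of \<open>L^2\<close>. Induction on \<open>n\<close> supplies the inequality for \<open>n - 1\<close> sides.

  A polygon at small distance from a regular one has nearly equal radii and nearly equal central
  angles, and both deviations are linear in the distance (\<open>variances_le_signed_deficit\<close>). The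
  passage to actual convex polygons only takes the inequality \<open>|P| \<le> |A|\<close>, which holds because
  the triangles spanned by the barycenter and the edges cover \<open>P\<close> (\<open>area_le_shoelace\<close>).

  The exponent is sharp because the deficit has a minimum at regular polygons: stretching a
  regular polygon by the factors \<open>1 + e\<close> and \<open>1 - e\<close> in the two coordinate directions changes
  the radii by an amount of order \<open>e\<close>, so their variance is at least of order \<open>e^2\<close>, whereas
  the deficit is at most of order \<open>e^2\<close>.
\<close>

section \<open>Polygons as cyclic sequences of complex numbers\<close>

lemma bij_betw_cyclic_shift: "bij_betw (\<lambda>k. (k + j) mod n) {..<n} {..<n::nat}"
proof (cases "n = 0")
  case False
  have "inj_on (\<lambda>k. (k + j) mod n) {..<n}"
  proof (rule inj_onI)
    fix x y assume "x \<in> {..<n}" "y \<in> {..<n}" "(x + j) mod n = (y + j) mod n"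
    then obtain p q where "x + j + n * p = y + j + n * q" by (auto simp: nat_mod_eq_iff)
    then have "x mod n = y mod n" by (intro nat_mod_eq_iff[THEN iffD2]) auto
    with \<open>x \<in> {..<n}\<close> \<open>y \<in> {..<n}\<close> show "x = y" by simp
  qed
  moreover have "(\<lambda>k. (k + j) mod n) ` {..<n} \<subseteq> {..<n}" using False by auto
  ultimately show ?thesis
    by (simp add: bij_betw_def endo_inj_surj)
qed (simp add: bij_betw_def)

lemma sum_cyclic_shift: "(\<Sum>k<n. f ((k + j) mod n)) = (\<Sum>k<n::nat. f k)"
  by (rule sum.reindex_bij_betw[OF bij_betw_cyclic_shift])

lemma sum_cyclic_Suc: "(\<Sum>k<n. f (Suc k mod n)) = (\<Sum>k<n::nat. f k)"
  using sum_cyclic_shift[of f 1 n] by simp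

text \<open>
  A signed area, positive for a counterclockwise triangle; no absolute value occurs, so that it is additive under
  deleting a vertex.
\<close>

definition tri_area :: "complex \<Rightarrow> complex \<Rightarrow> complex \<Rightarrow> real" where
  "tri_area b c d = Im (cnj (c - b) * (d - c)) / 2"

text \<open>
  The area enclosed by a simple closed polygon, positive if it is traversed counterclockwise.
\<close>

definition shoelace :: "nat \<Rightarrow> (nat \<Rightarrow> complex) \<Rightarrow> real" where
  "shoelace n z = (\<Sum>k<n. Im (cnj (z k) * z (Suc k mod n))) / 2"

definition side :: "nat \<Rightarrow> (nat \<Rightarrow> complex) \<Rightarrow> nat \<Rightarrow> real" where
  "side n z k = dist (z k) (z (Suc k mod n))"

definition circumference :: "nat \<Rightarrow> (nat \<Rightarrow> complex) \<Rightarrow> real" where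
  "circumference n z = (\<Sum>k<n. side n z k)"

definition energy :: "nat \<Rightarrow> (nat \<Rightarrow> complex) \<Rightarrow> real" where
  "energy n z = (\<Sum>k<n. (side n z k)\<^sup>2)"

section \<open>Discrete Fourier analysis of the isoperimetric form\<close>

definition primroot :: "nat \<Rightarrow> complex" where
  "primroot n = cis (2 * pi / real n)"

text \<open>
  Normalized so that \<open>z k\<close> is the plain sum of the modes, see \<open>dft_inversion\<close>; the mode \<open>1\<close>
  is then the regular polygon closest to \<open>z\<close>.
\<close>

definition dft :: "nat \<Rightarrow> (nat \<Rightarrow> complex) \<Rightarrow> nat \<Rightarrow> complex" where
  "dft n z m = (\<Sum>k<n. z k * cnj (primroot n) ^ (m * k)) / of_nat n"

lemma primroot_power: "primroot n ^ k = cis (2 * pi * real k / real n)"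
  by (simp add: primroot_def Complex.DeMoivre mult_ac)

lemma primroot_power_n: "n > 0 \<Longrightarrow> primroot n ^ n = 1"
  by (simp add: primroot_power)

lemma primroot_cnj: "primroot n * cnj (primroot n) = 1"
  by (simp add: primroot_def cis_cnj cis_mult)

lemma primroot_power_cnj: "primroot n ^ k * cnj (primroot n) ^ k = 1"
  by (metis power_mult_distrib primroot_cnj power_one)

lemma cmod_primroot_power: "cmod (primroot n ^ k) = 1"
  by (simp add: primroot_power)

lemma primroot_power_inj:
  assumes "m < n" "j < n" "primroot n ^ m = primroot n ^ j"
  shows "m = j"
proof -
  have "inj_on (\<lambda>k. cis (2 * pi * real k / real n)) {..<n}"
    using bij_betw_roots_unity[of n] assms(1) by (auto simp: bij_betw_def cis_conv_exp mult_ac)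
  then show ?thesis
    using assms by (auto simp: primroot_power inj_on_def)
qed

lemma primroot_power_Suc_mod:
  assumes "n > 0" shows "primroot n ^ (Suc k mod n) = primroot n ^ Suc k"
proof -
  have "primroot n ^ Suc k = primroot n ^ (Suc k div n * n + Suc k mod n)"
    by (simp only: div_mult_mod_eq)
  also have "\<dots> = (primroot n ^ n) ^ (Suc k div n) * primroot n ^ (Suc k mod n)"
    by (simp only: power_add power_mult mult.commute[of "Suc k div n"])
  finally show ?thesis using assms by (simp only: primroot_power_n power_one mult_1_left)
qed

lemma primroot_power_mult_Suc_mod:
  assumes "n > 0" shows "primroot n ^ (m * (Suc k mod n)) = primroot n ^ m * primroot n ^ (m * k)"
proof -
  have "primroot n ^ (m * (Suc k mod n)) = (primroot n ^ Suc k) ^ m"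
    by (metis assms primroot_power_Suc_mod mult.commute power_mult)
  also have "\<dots> = primroot n ^ (m + m * k)"
    by (metis mult.commute mult_Suc_right power_mult)
  finally show ?thesis by (simp add: power_add)
qed

lemma roots_of_unity_orthogonal:
  assumes "m < n" "j < n"
  shows "(\<Sum>k<n. primroot n ^ (m * k) * cnj (primroot n) ^ (j * k)) = (if m = j then of_nat n else 0)"
proof (cases "m = j")
  case True then show ?thesis by (simp add: primroot_power_cnj)
next
  case False
  define x where "x = primroot n ^ m * cnj (primroot n) ^ j"
  have n: "n > 0" using assms by simp
  have "x \<noteq> 1"
  proof
    assume "x = 1"
    have "primroot n ^ m = primroot n ^ m * (primroot n ^ j * cnj (primroot n) ^ j)"
      by (simp only: primroot_power_cnj mult_1_right)
    also have "\<dots> = x * primroot n ^ j" by (simp only: x_def mult_ac)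
    finally have "primroot n ^ m = primroot n ^ j" using \<open>x = 1\<close> by simp
    with primroot_power_inj assms False show False by blast
  qed
  moreover have "x ^ n = 1"
  proof -
    have "x ^ n = (primroot n ^ n) ^ m * cnj ((primroot n ^ n) ^ j)"
      by (simp add: x_def power_mult_distrib mult.commute flip: power_mult)
    then show ?thesis by (simp add: primroot_power_n n)
  qed
  ultimately have "(\<Sum>k<n. x ^ k) = 0" by (simp add: sum_gp_strict)
  then show ?thesis using False
    by (simp add: x_def power_mult_distrib power_mult)
qed

lemma dft_inversion:
  assumes "k < n" shows "(\<Sum>m<n. dft n z m * primroot n ^ (m * k)) = z k"
proof -
  let ?w = "primroot n"
  have "(\<Sum>m<n. dft n z m * ?w ^ (m * k))
      = (\<Sum>m<n. \<Sum>j<n. z j * (?w ^ (k * m) * cnj ?w ^ (j * m)) / of_nat n)"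
    by (simp add: dft_def sum_distrib_left sum_distrib_right sum_divide_distrib mult_ac)
  also have "\<dots> = (\<Sum>j<n. z j * (\<Sum>m<n. ?w ^ (k * m) * cnj ?w ^ (j * m)) / of_nat n)"
    by (subst sum.swap) (simp add: sum_distrib_left sum_divide_distrib)
  also have "\<dots> = (\<Sum>j<n. if k = j then z j else 0)"
    using assms by (intro sum.cong) (auto simp: roots_of_unity_orthogonal)
  also have "\<dots> = z k" using assms by simp
  finally show ?thesis .
qed

text \<open>
  The coefficients \<open>f m = 1\<close> give Parseval's identity. A cyclic shift multiplies the mode \<open>m\<close> by
  the \<open>m\<close>-th power of the root of unity, so \<open>f m = primroot n ^ m\<close> gives the autocorrelation, whose
  imaginary part is twice the shoelace area and whose real part enters the sum of squared sides.
\<close>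

lemma sum_cnj_mult_power:
  assumes "n > 0"
  shows "(\<Sum>k<n. cnj (z k) * (\<Sum>m<n. f m * dft n z m * primroot n ^ (m * k)))
     = of_nat n * (\<Sum>m<n. f m * of_real ((cmod (dft n z m))\<^sup>2))"
proof -
  let ?w = "primroot n"
  have c: "(\<Sum>k<n. cnj (z k) * ?w ^ (m * k)) = of_nat n * cnj (dft n z m)" for m
    using assms by (simp add: dft_def)
  have "(\<Sum>k<n. cnj (z k) * (\<Sum>m<n. f m * dft n z m * ?w ^ (m * k)))
      = (\<Sum>m<n. f m * dft n z m * (\<Sum>k<n. cnj (z k) * ?w ^ (m * k)))"
    by (simp add: sum_distrib_left mult_ac) (subst sum.swap, simp add: mult_ac)
  also have "\<dots> = of_nat n * (\<Sum>m<n. f m * of_real ((cmod (dft n z m))\<^sup>2))"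
    unfolding c by (simp add: sum_distrib_left complex_norm_square mult_ac del: of_real_power)
  finally show ?thesis .
qed

lemma dft_parseval:
  assumes "n > 0"
  shows "(\<Sum>k<n. (cmod (z k))\<^sup>2) = real n * (\<Sum>m<n. (cmod (dft n z m))\<^sup>2)"
proof -
  have "of_real (\<Sum>k<n. (cmod (z k))\<^sup>2) = (\<Sum>k<n. cnj (z k) * z k)"
    by (simp add: complex_norm_square mult.commute del: of_real_power)
  also have "\<dots> = (\<Sum>k<n. cnj (z k) * (\<Sum>m<n. 1 * dft n z m * primroot n ^ (m * k)))"
    by (simp add: dft_inversion)
  also have "\<dots> = of_real (real n * (\<Sum>m<n. (cmod (dft n z m))\<^sup>2))"
    unfolding sum_cnj_mult_power[OF assms] by simp
  finally show ?thesis using of_real_eq_iff by blast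
qed

lemma dft_autocorrelation:
  assumes "n > 0"
  shows "(\<Sum>k<n. cnj (z k) * z (Suc k mod n))
    = of_nat n * (\<Sum>m<n. primroot n ^ m * of_real ((cmod (dft n z m))\<^sup>2))"
proof -
  have "z (Suc k mod n) = (\<Sum>m<n. primroot n ^ m * dft n z m * primroot n ^ (m * k))" for k
    using dft_inversion[of "Suc k mod n" n z] assms
    by (simp add: primroot_power_mult_Suc_mod mult_ac)
  then show ?thesis using sum_cnj_mult_power[OF assms] by simp
qed

text \<open>
  The eigenvalues of the quadratic form \<open>energy - 4 tan (pi / n) shoelace\<close>.
\<close>

definition mode_weight :: "nat \<Rightarrow> nat \<Rightarrow> real" where
  "mode_weight n m = 4 * sin (pi * real m / real n) * sin (pi * (real m - 1) / real n) / cos (pi / real n)"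

lemma cos_pi_div_pos: "n \<ge> 3 \<Longrightarrow> cos (pi / real n) > 0"
  by (intro cos_gt_zero_pi) (auto simp: field_simps, smt (verit) pi_gt_zero mult_nonneg_nonneg of_nat_0_le_iff)

lemma mode_weight_eq:
  assumes "n \<ge> 3"
  shows "mode_weight n m = 2 - 2 * cos (2 * pi * real m / real n) - 2 * tan (pi / real n) * sin (2 * pi * real m / real n)"
proof -
  define a where "a = pi * real m / real n"
  define b where "b = pi / real n"
  have cb: "cos b > 0" using cos_pi_div_pos[OF assms] by (simp add: b_def)
  have 1: "2 * pi * real m / real n = 2 * a" "pi * (real m - 1) / real n = a - b"
    by (simp_all add: a_def b_def field_simps diff_divide_distrib)
  have "sin (a - b) / cos b = sin a - cos a * tan b"
    using cb by (simp add: sin_diff tan_def field_simps)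
  then have "mode_weight n m = 4 * sin a * (sin a - cos a * tan b)"
    unfolding mode_weight_def 1 a_def[symmetric] b_def[symmetric]
    by (metis times_divide_eq_right)
  also have "\<dots> = 4 * (sin a)\<^sup>2 - 2 * tan b * (2 * sin a * cos a)"
    by (simp add: power2_eq_square algebra_simps)
  also have "\<dots> = 2 - 2 * cos (2 * a) - 2 * tan b * sin (2 * a)"
    by (simp add: cos_double_sin sin_double)
  finally show ?thesis by (simp add: 1 flip: b_def)
qed

lemma mode_weight_0: "mode_weight n 0 = 0" and mode_weight_1: "mode_weight n 1 = 0"
  by (simp_all add: mode_weight_def)

lemma mode_weight_pos:
  assumes "2 \<le> m" "m < n" shows "mode_weight n m > 0"
proof -
  have n: "n \<ge> 3" using assms by simp
  have "sin (pi * real m / real n) > 0"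
    using assms by (intro sin_gt_zero) (auto simp: field_simps)
  moreover have "sin (pi * (real m - 1) / real n) > 0"
  proof (intro sin_gt_zero)
    have "pi * (real m - 1) < pi * real n" using assms by (intro mult_strict_left_mono) auto
    then show "pi * (real m - 1) / real n < pi" using assms by (simp add: field_simps)
  qed (use assms in auto)
  ultimately show ?thesis using cos_pi_div_pos[OF n] by (simp add: mode_weight_def)
qed

lemma side_power2: "(side n z k)\<^sup>2 = (cmod (z k))\<^sup>2 + (cmod (z (Suc k mod n)))\<^sup>2 - 2 * Re (cnj (z k) * z (Suc k mod n))"
  by (simp add: side_def dist_norm cmod_power2 power2_diff)

lemma energy_eq: "energy n z = 2 * (\<Sum>k<n. (cmod (z k))\<^sup>2) - 2 * Re (\<Sum>k<n. cnj (z k) * z (Suc k mod n))"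
  unfolding energy_def side_power2 sum_subtractf sum.distrib
    sum_cyclic_Suc[of "\<lambda>k. (cmod (z k))\<^sup>2" n] by (simp add: sum_distrib_left)

lemma energy_excess_eq:
  assumes "n \<ge> 3"
  shows "energy n z - 4 * tan (pi / real n) * shoelace n z
       = real n * (\<Sum>m<n. mode_weight n m * (cmod (dft n z m))\<^sup>2)"
proof -
  have n: "n > 0" using assms by simp
  have s: "2 * shoelace n z = Im (\<Sum>k<n. cnj (z k) * z (Suc k mod n))"
    by (simp add: shoelace_def)
  have R: "Re (\<Sum>k<n. cnj (z k) * z (Suc k mod n)) = real n * (\<Sum>m<n. cos (2 * pi * real m / real n) * (cmod (dft n z m))\<^sup>2)"
   and I: "Im (\<Sum>k<n. cnj (z k) * z (Suc k mod n)) = real n * (\<Sum>m<n. sin (2 * pi * real m / real n) * (cmod (dft n z m))\<^sup>2)"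
    unfolding dft_autocorrelation[OF n] by (simp_all add: primroot_power del: of_real_power)
  have "energy n z - 4 * tan (pi / real n) * shoelace n z = 
     2 * (real n * (\<Sum>m<n. (cmod (dft n z m))\<^sup>2)) - 2 * Re (\<Sum>k<n. cnj (z k) * z (Suc k mod n))
      - 2 * tan (pi / real n) * Im (\<Sum>k<n. cnj (z k) * z (Suc k mod n))"
    unfolding energy_eq dft_parseval[OF n, of z] using s by simp
  also have "\<dots> = real n * (\<Sum>m<n. mode_weight n m * (cmod (dft n z m))\<^sup>2)"
    unfolding R I mode_weight_eq[OF assms]
    by (simp add: sum_distrib_left sum_subtractf left_diff_distrib right_diff_distrib mult_ac)
  finally show ?thesis .
qed

lemma mode_weight_nonneg: "m < n \<Longrightarrow> mode_weight n m \<ge> 0"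
proof -
  assume "m < n"
  consider "m = 0" | "m = 1" | "2 \<le> m" by linarith
  then show ?thesis using mode_weight_pos[of m n] \<open>m < n\<close>
    by cases (auto simp: mode_weight_0 mode_weight_1[unfolded One_nat_def] less_imp_le)
qed

lemma energy_excess_nonneg:
  "n \<ge> 3 \<Longrightarrow> energy n z - 4 * tan (pi / real n) * shoelace n z \<ge> 0"
  by (subst energy_excess_eq) (auto intro!: sum_nonneg mult_nonneg_nonneg mode_weight_nonneg)

text \<open>
  With the barycenter at the origin the mode \<open>0\<close> vanishes. Removing the mode \<open>1\<close> leaves the modes
  \<open>2, \<dots>, n - 1\<close>, whose weights are bounded below by a positive constant.
\<close>

lemma energy_excess_coercive:
  assumes "n \<ge> 3"
  shows "\<exists>l>0. \<forall>z. (\<Sum>k<n. z k) = 0 \<longrightarrow>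
    l * (\<Sum>k<n. (cmod (z k - dft n z 1 * primroot n ^ k))\<^sup>2)
      \<le> energy n z - 4 * tan (pi / real n) * shoelace n z"
proof -
  define l where "l = Min (mode_weight n ` {2..<n})"
  have l: "l > 0" unfolding l_def
    using assms by (subst Min_gr_iff) (auto intro: mode_weight_pos)
  have le: "l \<le> mode_weight n m" if "2 \<le> m" "m < n" for m
    unfolding l_def using that by (intro Min_le) auto
  have n: "n > 0" using assms by simp
  show ?thesis
  proof (intro exI[of _ l] conjI l allI impI)
    fix z :: "nat \<Rightarrow> complex" assume z0: "(\<Sum>k<n. z k) = 0"
    define a where "a = dft n z 1"
    have c0: "dft n z 0 = 0" using z0 by (simp add: dft_def)
    have pt: "(cmod (z k - a * primroot n ^ k))\<^sup>2 = (cmod (z k))\<^sup>2 + (cmod a)\<^sup>2 - 2 * Re (cnj a * (z k * cnj (primroot n) ^ k))" for k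
    proof -
      have *: "(cmod (u - v))\<^sup>2 = (cmod u)\<^sup>2 + (cmod v)\<^sup>2 - 2 * Re (u * cnj v)" for u v
        by (simp add: cmod_power2 power2_diff)
      show ?thesis unfolding * by (simp add: norm_mult norm_power primroot_def mult_ac)
    qed
    have "(\<Sum>k<n. (cmod (z k - a * primroot n ^ k))\<^sup>2) =
        (\<Sum>k<n. (cmod (z k))\<^sup>2) + n * (cmod a)\<^sup>2 - 2 * Re (cnj a * (\<Sum>k<n. z k * cnj (primroot n) ^ k))"
      unfolding pt by (simp add: sum.distrib sum_subtractf sum_distrib_left)
    also have "(\<Sum>k<n. z k * cnj (primroot n) ^ k) = of_nat n * a"
      using n by (simp add: a_def dft_def)
    also have "Re (cnj a * (of_nat n * a)) = real n * (cmod a)\<^sup>2"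
      by (simp add: cmod_power2) (simp add: power2_eq_square algebra_simps)
    also have "(\<Sum>k<n. (cmod (z k))\<^sup>2) + real n * (cmod a)\<^sup>2 - 2 * (real n * (cmod a)\<^sup>2)
         = real n * ((\<Sum>m<n. (cmod (dft n z m))\<^sup>2) - (cmod a)\<^sup>2)"
      unfolding dft_parseval[OF n, of z] by (simp add: algebra_simps)
    finally have E: "(\<Sum>k<n. (cmod (z k - a * primroot n ^ k))\<^sup>2) = real n * ((\<Sum>m<n. (cmod (dft n z m))\<^sup>2) - (cmod a)\<^sup>2)" .
    have "l * ((\<Sum>m<n. (cmod (dft n z m))\<^sup>2) - (cmod a)\<^sup>2) = (\<Sum>m<n. (l * (cmod (dft n z m))\<^sup>2 - (if m = 1 then l * (cmod a)\<^sup>2 else 0)))"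
      using assms by (simp add: sum_subtractf sum_distrib_left right_diff_distrib)
    also have "\<dots> \<le> (\<Sum>m<n. mode_weight n m * (cmod (dft n z m))\<^sup>2)"
    proof (intro sum_mono)
      fix m assume "m \<in> {..<n}"
      then consider "m = 0" | "m = 1" | "2 \<le> m" "m < n" by fastforce
      then show "l * (cmod (dft n z m))\<^sup>2 - (if m = 1 then l * (cmod a)\<^sup>2 else 0) \<le> mode_weight n m * (cmod (dft n z m))\<^sup>2"
        by cases (simp_all add: c0 a_def mode_weight_1[unfolded One_nat_def] mult_right_mono le)
    qed
    finally show "l * (\<Sum>k<n. (cmod (z k - dft n z 1 * primroot n ^ k))\<^sup>2)
      \<le> energy n z - 4 * tan (pi / real n) * shoelace n z"
      unfolding energy_excess_eq[OF assms] E[unfolded a_def] mult.left_commute[of l]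
      unfolding a_def by (intro mult_left_mono) auto
  qed
qed

section \<open>Equalizing two adjacent sides\<close>

text \<open>
  Heron's formula, written with the sum and the difference of the two sides \<open>u\<close> and \<open>v\<close>: for a fixed
  base \<open>u + v\<close> and a fixed sum of the sides the area decreases in their difference.
\<close>

lemma cross_power2_eq:
  "4 * (Im (cnj u * v))\<^sup>2 = ((cmod u + cmod v)\<^sup>2 - (cmod (u + v))\<^sup>2) * ((cmod (u + v))\<^sup>2 - (cmod u - cmod v)\<^sup>2)"
proof -
  define p where "p = cmod u"
  define q where "q = cmod v"
  define r where "r = Re u * Re v + Im u * Im v"
  have e: "(cmod (u + v))\<^sup>2 = p\<^sup>2 + q\<^sup>2 + 2 * r"
    by (simp add: p_def q_def r_def cmod_power2 power2_sum)
  have "(Im (cnj u * v))\<^sup>2 = p\<^sup>2 * q\<^sup>2 - r\<^sup>2"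
    by (simp add: p_def q_def r_def cmod_power2) (simp add: power2_eq_square algebra_simps)
  moreover have "((p + q)\<^sup>2 - (cmod (u + v))\<^sup>2) * ((cmod (u + v))\<^sup>2 - (p - q)\<^sup>2) = 4 * (p\<^sup>2 * q\<^sup>2 - r\<^sup>2)"
    unfolding e by (simp add: power2_eq_square algebra_simps)
  ultimately show ?thesis by (simp add: p_def q_def)
qed

lemma tri_area_le:
  fixes b c d :: complex
  defines "s \<equiv> dist b c + dist c d" and "t \<equiv> dist c d - dist b c" and "e \<equiv> dist b d"
  shows "tri_area b c d \<le> sqrt (s\<^sup>2 - e\<^sup>2) * sqrt (e\<^sup>2 - t\<^sup>2) / 4" "\<bar>t\<bar> \<le> e" "e \<le> s"
proof -
  have "16 * (tri_area b c d)\<^sup>2 = (s\<^sup>2 - e\<^sup>2) * (e\<^sup>2 - t\<^sup>2)"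
    using cross_power2_eq[of "c - b" "d - c"]
    by (simp add: tri_area_def power_divide s_def t_def e_def dist_norm norm_minus_commute power2_commute)
  then have "(4 * tri_area b c d)\<^sup>2 = (s\<^sup>2 - e\<^sup>2) * (e\<^sup>2 - t\<^sup>2)" by (simp add: power_mult_distrib)
  then have "\<bar>4 * tri_area b c d\<bar> = sqrt ((s\<^sup>2 - e\<^sup>2) * (e\<^sup>2 - t\<^sup>2))"
    by (metis real_sqrt_abs)
  then show "tri_area b c d \<le> sqrt (s\<^sup>2 - e\<^sup>2) * sqrt (e\<^sup>2 - t\<^sup>2) / 4"
    by (simp add: real_sqrt_mult)
  show "\<bar>t\<bar> \<le> e" unfolding t_def e_def by metric
  show "e \<le> s" unfolding s_def e_def by metric
qed

text \<open>
  The height of the isosceles triangle is half of \<open>sqrt (s^2 - |b - d|^2)\<close>, and the apex lies to the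
  right of the line from \<open>b\<close> to \<open>d\<close>, so that \<open>b, c, d\<close> is a counterclockwise turn.
\<close>

lemma isosceles_apex:
  fixes b d :: complex
  assumes "b \<noteq> d" "dist b d \<le> s"
  shows "\<exists>c. dist b c = s / 2 \<and> dist c d = s / 2 \<and>
    tri_area b c d = dist b d * sqrt (s\<^sup>2 - (dist b d)\<^sup>2) / 4"
proof -
  define e where "e = dist b d"
  define h where "h = sqrt (s\<^sup>2 - e\<^sup>2) / (2 * e)"
  have e: "e > 0" "e \<le> s" "e = cmod (d - b)" using assms by (auto simp: e_def dist_norm norm_minus_commute)
  then have "s\<^sup>2 - e\<^sup>2 \<ge> 0" using power_mono[of e s 2] by simp
  then have h2: "1 / 4 + h\<^sup>2 = s\<^sup>2 / (4 * e\<^sup>2)"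
    using e(1) by (simp add: h_def power_divide power_mult_distrib) (simp add: field_simps)
  define c where "c = b + (d - b) * Complex (1/2) (- h)"
  have m: "cmod (Complex (1/2) x) = s / (2 * e)" if "x\<^sup>2 = h\<^sup>2" for x
  proof -
    have "(1/2)\<^sup>2 + x\<^sup>2 = (s / (2 * e))\<^sup>2"
      using h2 that by (simp add: power_divide power_mult_distrib)
    then have "cmod (Complex (1/2) x) = sqrt ((s / (2 * e))\<^sup>2)" by (simp only: complex_norm)
    also have "\<dots> = s / (2 * e)" using e(1,2) by simp
    finally show ?thesis .
  qed
  have cb: "c - b = (d - b) * Complex (1/2) (- h)" by (simp add: c_def)
  have half: "Complex (1/2) (- h) + Complex (1/2) h = 1" by (simp add: complex_eq_iff)
  have "d - c = (d - b) - (d - b) * Complex (1/2) (- h)" by (simp add: c_def)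
  also have "\<dots> = (d - b) * (Complex (1/2) (- h) + Complex (1/2) h) - (d - b) * Complex (1/2) (- h)"
    by (simp only: half mult_1_right)
  also have "\<dots> = (d - b) * Complex (1/2) h"
    by (simp only: distrib_left add_diff_cancel_left')
  finally have dc: "d - c = (d - b) * Complex (1/2) h" .
  have "dist b c = e * cmod (Complex (1/2) (- h))"
    using cb e(3) by (simp add: dist_norm norm_minus_commute[of b] norm_mult)
  also have "\<dots> = s / 2" using m[of "- h"] e by simp
  finally have 1: "dist b c = s / 2" .
  have "dist c d = e * cmod (Complex (1/2) h)"
    using dc e(3) by (simp add: dist_norm norm_minus_commute[of c] norm_mult)
  also have "\<dots> = s / 2" using m[of h] e by simp
  finally have 2: "dist c d = s / 2" .
  have "cnj (c - b) * (d - c) = (d - b) * cnj (d - b) * (cnj (Complex (1/2) (- h)) * Complex (1/2) h)"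
    unfolding cb dc by (simp add: mult_ac)
  also have "(d - b) * cnj (d - b) = of_real (e\<^sup>2)"
    by (simp only: e(3) complex_norm_square)
  finally have "tri_area b c d = e\<^sup>2 * h / 2"
    by (simp add: tri_area_def del: of_real_power)
  also have "\<dots> = e * sqrt (s\<^sup>2 - e\<^sup>2) / 4" using e by (simp add: h_def power2_eq_square)
  finally show ?thesis using 1 2 by (auto simp: e_def)
qed

lemma sum_cyclic_pairs:
  "(\<Sum>k<Suc N. f (z k) (z (Suc k mod Suc N))) = (\<Sum>k<N. f (z k) (z (Suc k))) + f (z N) (z 0)"
  by (simp add: sum.lessThan_Suc)

lemma shoelace_remove_last:
  "shoelace (Suc (Suc N)) z = shoelace (Suc N) z + tri_area (z N) (z (Suc N)) (z 0)"
  unfolding shoelace_def tri_area_def sum_cyclic_pairs[of "\<lambda>a b. Im (cnj a * b)"]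
  by (simp add: algebra_simps add_divide_distrib diff_divide_distrib)

lemma circumference_eq:
  "circumference (Suc N) z = (\<Sum>k<N. dist (z k) (z (Suc k))) + dist (z N) (z 0)"
  unfolding circumference_def side_def by (rule sum_cyclic_pairs)

lemma energy_eq_pairs:
  "energy (Suc N) z = (\<Sum>k<N. (dist (z k) (z (Suc k)))\<^sup>2) + (dist (z N) (z 0))\<^sup>2"
  unfolding energy_def side_def by (rule sum_cyclic_pairs)

lemma circumference_remove_last:
  "circumference (Suc N) z \<le> circumference (Suc (Suc N)) z"
  using dist_triangle[of "z N" "z 0" "z (Suc N)"] by (simp add: circumference_eq)

lemma side_nonneg: "side n z k \<ge> 0" by (simp add: side_def)

lemma circumference_nonneg: "circumference n z \<ge> 0"
  by (simp add: circumference_def sum_nonneg side_nonneg)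

lemma energy_le_circumference: "energy n z \<le> (circumference n z)\<^sup>2"
proof -
  have "L2_set (side n z) {..<n} \<le> circumference n z"
    unfolding circumference_def by (rule L2_set_le_sum) (auto simp: side_nonneg)
  then have "(L2_set (side n z) {..<n})\<^sup>2 \<le> (circumference n z)\<^sup>2"
    by (rule power_mono) (simp add: L2_set_def sum_nonneg)
  then show ?thesis by (simp add: L2_set_def energy_def sum_nonneg)
qed

lemma side_rotate:
  "n > 0 \<Longrightarrow> side n (\<lambda>k. z ((k + j) mod n)) k = side n z ((k + j) mod n)"
  by (simp add: side_def mod_simps)

lemma circumference_rotate: "n > 0 \<Longrightarrow> circumference n (\<lambda>k. z ((k + j) mod n)) = circumference n z"
  and energy_rotate: "n > 0 \<Longrightarrow> energy n (\<lambda>k. z ((k + j) mod n)) = energy n z"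
  by (simp_all add: circumference_def energy_def side_rotate sum_cyclic_shift
      sum_cyclic_shift[of "\<lambda>k. (side n z k)\<^sup>2"])

lemma shoelace_rotate: "n > 0 \<Longrightarrow> shoelace n (\<lambda>k. z ((k + j) mod n)) = shoelace n z"
  using sum_cyclic_shift[of "\<lambda>k. Im (cnj (z k) * z (Suc k mod n))" j n]
  by (simp add: shoelace_def mod_simps)

text \<open>
  If all cyclic differences are small, all values are close to the first one. The largest
  cyclic difference therefore controls the variance.
\<close>

lemma cyclic_variance_le_step:
  fixes f :: "nat \<Rightarrow> real"
  assumes "n > 0"
  shows "\<exists>i<n. real n * (\<Sum>k<n. (f k)\<^sup>2) - (\<Sum>k<n. f k)\<^sup>2 \<le> real n ^ 4 * (f (Suc i mod n) - f i)\<^sup>2"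
proof -
  let ?d = "\<lambda>i. \<bar>f (Suc i mod n) - f i\<bar>"
  have "Max (?d ` {..<n}) \<in> ?d ` {..<n}" using assms by (intro Max_in) auto
  then obtain i where i: "i < n" "?d i = Max (?d ` {..<n})" by (metis (no_types, lifting) imageE lessThan_iff)
  then have i: "i < n" "\<And>j. j < n \<Longrightarrow> ?d j \<le> ?d i" by auto
  have near: "\<bar>f k - f 0\<bar> \<le> real k * ?d i" if "k < n" for k
    using that
  proof (induction k)
    case (Suc k)
    then have "\<bar>f (Suc k) - f k\<bar> \<le> ?d i" using i(2)[of k] by simp
    then show ?case using Suc by (simp add: algebra_simps)
  qed simp
  have "real n * (\<Sum>k<n. (f k)\<^sup>2) - (\<Sum>k<n. f k)\<^sup>2 = real n * (\<Sum>k<n. (f k - f 0)\<^sup>2) - (\<Sum>k<n. f k - f 0)\<^sup>2"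
    by (simp add: power2_diff sum_subtractf sum.distrib algebra_simps flip: sum_distrib_left)
      (simp add: power2_eq_square algebra_simps flip: sum_distrib_left sum_distrib_right)
  also have "\<dots> \<le> real n * (\<Sum>k<n. (f k - f 0)\<^sup>2)" by simp
  also have "\<dots> \<le> real n * (\<Sum>k<n. (real n * ?d i)\<^sup>2)"
  proof (intro mult_left_mono sum_mono)
    fix k assume "k \<in> {..<n}"
    then have "\<bar>f k - f 0\<bar> \<le> real n * ?d i"
      using near[of k] mult_right_mono[of "real k" "real n" "?d i"] by simp
    then show "(f k - f 0)\<^sup>2 \<le> (real n * ?d i)\<^sup>2"
      using power_mono[of "\<bar>f k - f 0\<bar>" _ 2] by simp
  qed simp
  also have "\<dots> = real n ^ 4 * (f (Suc i mod n) - f i)\<^sup>2"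
    by (simp add: power_mult_distrib power2_eq_square power4_eq_xxxx)
  finally show ?thesis using i(1) by blast
qed

text \<open>
  The gain of area is \<open>sqrt (s^2 - e^2) (e - sqrt (e^2 - t^2)) / 4\<close>, and the second factor is at
  least \<open>t^2 / (2 e)\<close>. The assumption on \<open>k\<close> keeps the first factor from degenerating: it
  excludes that the vertex nearly lies on the segment between its neighbours.
\<close>

lemma equalize_last_sides:
  fixes z :: "nat \<Rightarrow> complex" and N :: nat
  defines "n \<equiv> Suc (Suc N)"
  defines "s \<equiv> side n z N + side n z (Suc N)" and "t \<equiv> side n z (Suc N) - side n z N"
    and "e \<equiv> dist (z N) (z 0)"
  assumes N: "N \<ge> 1" and "k \<ge> 0" and e: "e > 0" and steep: "k * e \<le> sqrt (s\<^sup>2 - e\<^sup>2)"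
  shows "\<exists>z'. circumference n z' = circumference n z \<and> energy n z' = energy n z - t\<^sup>2 / 2 \<and>
     shoelace n z' \<ge> shoelace n z + k * t\<^sup>2 / 8"
proof -
  have sides: "side n z N = dist (z N) (z (Suc N))" "side n z (Suc N) = dist (z (Suc N)) (z 0)"
    by (simp_all add: side_def n_def)
  note tri = tri_area_le[where b = "z N" and c = "z (Suc N)" and d = "z 0", folded sides, folded s_def t_def e_def]
  obtain c where c: "dist (z N) c = s / 2" "dist c (z 0) = s / 2"
      "tri_area (z N) c (z 0) = e * sqrt (s\<^sup>2 - e\<^sup>2) / 4"
    using isosceles_apex[of "z N" "z 0" s, folded e_def] tri(3) e by (force simp: e_def)
  define z' where "z' = z(Suc N := c)"
  have z': "z' k = z k" if "k \<noteq> Suc N" for k using that by (simp add: z'_def)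
  have zN: "z' (Suc N) = c" by (simp add: z'_def)
  have "circumference n z' = circumference n z"
    using c by (simp add: n_def circumference_eq z' zN s_def sides[unfolded n_def])
  moreover have "energy n z' = energy n z - t\<^sup>2 / 2"
  proof -
    have "(s / 2)\<^sup>2 + (s / 2)\<^sup>2 = (side n z N)\<^sup>2 + (side n z (Suc N))\<^sup>2 - t\<^sup>2 / 2"
      by (simp add: s_def t_def power2_eq_square field_simps)
    then show ?thesis
      by (simp add: n_def energy_eq_pairs z' zN sides[unfolded n_def] c(1,2))
  qed
  moreover have "shoelace n z' \<ge> shoelace n z + k * t\<^sup>2 / 8"
  proof -
    have same: "shoelace (Suc N) z' = shoelace (Suc N) z"
      unfolding shoelace_def sum_cyclic_pairs[of "\<lambda>a b. Im (cnj a * b)"] using N by (simp add: z')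
    have te: "t\<^sup>2 \<le> e\<^sup>2" using tri(2) abs_le_square_iff[of t e] by simp
    have "e\<^sup>2 - t\<^sup>2 \<le> (e - t\<^sup>2 / (2 * e))\<^sup>2"
      using e by (simp add: power2_diff)
    moreover have "t\<^sup>2 / (2 * e) \<le> e"
    proof -
      have "t\<^sup>2 \<le> e * (2 * e)" using te zero_le_power2[of e] unfolding power2_eq_square by linarith
      then show ?thesis using e by (simp add: divide_le_eq)
    qed
    ultimately have "sqrt (e\<^sup>2 - t\<^sup>2) \<le> e - t\<^sup>2 / (2 * e)"
      by (intro real_le_lsqrt) (auto simp: te)
    then have "(k * e) * (t\<^sup>2 / (2 * e)) \<le> sqrt (s\<^sup>2 - e\<^sup>2) * (e - sqrt (e\<^sup>2 - t\<^sup>2))"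
      using e steep \<open>k \<ge> 0\<close> power_mono[OF tri(3), of 2] by (intro mult_mono) auto
    then have "k * t\<^sup>2 / 8 \<le> tri_area (z N) c (z 0) - sqrt (s\<^sup>2 - e\<^sup>2) * sqrt (e\<^sup>2 - t\<^sup>2) / 4"
      using e unfolding c(3) by (simp add: algebra_simps)
    also have "\<dots> \<le> tri_area (z N) c (z 0) - tri_area (z N) (z (Suc N)) (z 0)"
      using tri(1) by simp
    also have "\<dots> = shoelace n z' - shoelace n z"
      by (simp add: n_def shoelace_remove_last same z' zN)
    finally show ?thesis by simp
  qed
  ultimately show ?thesis by blast
qed

section \<open>The deficit controls the spread of the side lengths\<close>

text \<open>
  By the variance formula this is \<open>n^2\<close> times the variance of the side lengths.
\<close>

definition side_spread :: "nat \<Rightarrow> (nat \<Rightarrow> complex) \<Rightarrow> real" where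
  "side_spread n z = real n * energy n z - (circumference n z)\<^sup>2"

text \<open>
  The deficit with the shoelace area in place of the area of the enclosed region.
\<close>

definition signed_deficit :: "nat \<Rightarrow> (nat \<Rightarrow> complex) \<Rightarrow> real" where
  "signed_deficit n z = (circumference n z)\<^sup>2 - 4 * real n * tan (pi / real n) * shoelace n z"

lemma side_spread_nonneg: "side_spread n z \<ge> 0"
  using Cauchy_Schwarz_ineq_sum[of "\<lambda>_. 1" "side n z" "{..<n}"]
  by (simp add: side_spread_def energy_def circumference_def)

lemma signed_deficit_ge_spread:
  assumes "n \<ge> 3" shows "signed_deficit n z \<ge> - side_spread n z"
proof -
  have "signed_deficit n z + side_spread n z = real n * (energy n z - 4 * tan (pi / real n) * shoelace n z)"
    by (simp add: signed_deficit_def side_spread_def algebra_simps)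
  with energy_excess_nonneg[OF assms, of z] show ?thesis
    by (smt (verit) mult_nonneg_nonneg of_nat_0_le_iff)
qed

lemma tan_pi_div_pos: "n \<ge> 3 \<Longrightarrow> tan (pi / real n) > 0"
  by (intro tan_gt_zero divide_strict_left_mono) auto

text \<open>
  The function \<open>tan x / x\<close> is increasing on \<open>(0, pi/2)\<close>. Hence the largest area for
  a given length increases strictly with the number of sides; this strictness pays for the error made by
  deleting a vertex with an almost straight angle.
\<close>

lemma n_tan_pi_div_decreasing:
  assumes "n \<ge> 3"
  shows "real (Suc n) * tan (pi / real (Suc n)) < real n * tan (pi / real n)"
proof -
  let ?f = "\<lambda>x. tan x / x"
  have "?f (pi / real (Suc n)) < ?f (pi / real n)"
  proof (rule DERIV_pos_imp_increasing[where f = ?f])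
    show "pi / real (Suc n) < pi / real n" using assms by (intro divide_strict_left_mono) auto
    fix x assume x: "pi / real (Suc n) \<le> x" "x \<le> pi / real n"
    have "0 < pi / real (Suc n)" by simp
    moreover have "pi / real n < pi / 2" using assms by (intro divide_strict_left_mono) auto
    ultimately have x0: "0 < x" "x < pi / 2" using x by linarith+
    then have c: "cos x > 0" by (intro cos_gt_zero) auto
    have "cos x < 1" using cos_monotone_0_pi[of 0 x] x0 by simp
    moreover have "sin x > 0" using x0 by (intro sin_gt_zero) auto
    ultimately have "sin x * cos x < sin x" by simp
    also have "sin x \<le> x" using x0 by (intro sin_x_le_x) auto
    finally have pos: "x - sin x * cos x > 0" by simp
    have "(?f has_real_derivative (inverse ((cos x)\<^sup>2) * x - tan x * 1) / (x * x)) (at x)"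
      using x0 c by (intro DERIV_divide DERIV_tan DERIV_ident) auto
    also have "(inverse ((cos x)\<^sup>2) * x - tan x * 1) / (x * x) = (x - sin x * cos x) / (x\<^sup>2 * (cos x)\<^sup>2)"
      using x0 c by (simp add: tan_def field_simps power2_eq_square)
    finally have "(?f has_real_derivative (x - sin x * cos x) / (x\<^sup>2 * (cos x)\<^sup>2)) (at x)" .
    moreover have "(x - sin x * cos x) / (x\<^sup>2 * (cos x)\<^sup>2) > 0" using pos x0 c by simp
    ultimately show "\<exists>y. DERIV ?f x :> y \<and> y > 0" by blast
  qed
  then have "pi * ?f (pi / real (Suc n)) < pi * ?f (pi / real n)"
    by (intro mult_strict_left_mono) auto
  then show ?thesis by (simp add: mult.commute)
qed

text \<open>
  The induction step on the number of vertices. The constant \<open>m\<close> of the polygons with one vertex less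
  is strictly smaller than the one aimed at for \<open>n\<close> vertices, by the relative amount \<open>gap\<close>. The
  factor \<open>kappa\<close> is chosen such that the penalty \<open>kappa * side_spread\<close>, which is at most
  \<open>gap / 4 * L^2\<close>, is absorbed by this gap.
\<close>

context
  fixes N :: nat and n :: nat and m :: real
  assumes N: "N \<ge> 1" and n: "n = Suc (Suc N)" and m: "m \<ge> 0"
    and small: "4 * (real n * tan (pi / real n)) * m < 1"
    and IH: "\<And>z. shoelace (Suc N) z \<le> m * (circumference (Suc N) z)\<^sup>2"
begin

definition "gap = 1 - 4 * (real n * tan (pi / real n)) * m"
definition "kappa = gap / (4 * real n)"

definition penalized :: "(nat \<Rightarrow> complex) \<Rightarrow> real" where
  "penalized z = signed_deficit n z - kappa * side_spread n z"

lemma tan_pos: "tan (pi / real n) > 0"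
  using tan_pi_div_pos[of n] N n by simp

lemma gap_pos: "gap > 0"
  using small by (simp add: gap_def)

lemma kappa_pos: "kappa > 0"
  using gap_pos N n unfolding kappa_def by (intro divide_pos_pos) auto

lemma side_spread_le: "side_spread n z \<le> real n * (circumference n z)\<^sup>2"
  using mult_left_mono[OF energy_le_circumference[of n z], of "real n"]
  by (simp add: side_spread_def) (smt (verit) zero_le_power2)

lemma chord_le_circumference: "dist (z N) (z 0) \<le> circumference n z"
proof -
  have "dist (z N) (z 0) \<le> circumference (Suc N) z"
    by (simp add: circumference_eq sum_nonneg)
  then show ?thesis using circumference_remove_last[of N z] n by simp
qed

text \<open>
  Deleting the last vertex loses a triangle whose area is at most \<open>k / 4\<close> times the square of its
  base, by Heron's formula.
\<close>

lemma shoelace_le_flat: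
  assumes "k \<ge> 0" "sqrt ((side n z N + side n z (Suc N))\<^sup>2 - (dist (z N) (z 0))\<^sup>2) \<le> k * dist (z N) (z 0)"
  shows "shoelace n z \<le> (m + k / 4) * (circumference n z)\<^sup>2"
proof -
  define e where "e = dist (z N) (z 0)"
  let ?s = "side n z N + side n z (Suc N)" and ?t = "side n z (Suc N) - side n z N"
  have sides: "side n z N = dist (z N) (z (Suc N))" "side n z (Suc N) = dist (z (Suc N)) (z 0)"
    by (simp_all add: side_def n)
  have e: "0 \<le> e" "e \<le> circumference n z" using chord_le_circumference by (auto simp: e_def)
  have "4 * tri_area (z N) (z (Suc N)) (z 0) \<le> sqrt (?s\<^sup>2 - e\<^sup>2) * sqrt (e\<^sup>2 - ?t\<^sup>2)"
    using tri_area_le(1)[of "z N" "z (Suc N)" "z 0"] by (simp add: sides e_def)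
  also have "\<dots> \<le> (k * e) * e"
  proof (intro mult_mono)
    have "sqrt (e\<^sup>2 - ?t\<^sup>2) \<le> sqrt (e\<^sup>2)" by (intro real_sqrt_le_mono) simp
    then show "sqrt (e\<^sup>2 - ?t\<^sup>2) \<le> e" using e by simp
    have "?t\<^sup>2 \<le> e\<^sup>2" using tri_area_le(2)[where b = "z N" and c = "z (Suc N)" and d = "z 0"]
      by (metis abs_le_square_iff abs_of_nonneg e(1) e_def sides)
    then show "0 \<le> sqrt (e\<^sup>2 - ?t\<^sup>2)" by simp
  qed (use assms e in \<open>auto simp: e_def\<close>)
  also have "\<dots> \<le> k * (circumference n z)\<^sup>2"
    using e assms power_mono[of e "circumference n z" 2]
    by (simp add: mult_left_mono power2_eq_square mult.assoc)
  finally have "tri_area (z N) (z (Suc N)) (z 0) \<le> k / 4 * (circumference n z)\<^sup>2" by simp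
  moreover have "shoelace (Suc N) z \<le> m * (circumference n z)\<^sup>2"
    using IH[of z] circumference_remove_last[of N z] n m
      mult_left_mono[OF power_mono[of "circumference (Suc N) z" "circumference n z" 2], of m]
      circumference_nonneg[of "Suc N" z] by force
  ultimately show ?thesis using shoelace_remove_last[of N z] n by (simp add: algebra_simps)
qed

text \<open>
  A triangle has at most half the area of the rectangle over two of its sides, and these are at most
  the whole length.
\<close>

lemma shoelace_le_crude: "shoelace n z \<le> (m + 1) * (circumference n z)\<^sup>2"
proof -
  let ?b = "z N" and ?c = "z (Suc N)" and ?d = "z 0"
  have "2 * tri_area ?b ?c ?d \<le> cmod (cnj (?c - ?b) * (?d - ?c))"
    unfolding tri_area_def by (metis abs_Im_le_cmod abs_le_D1 mult.commute nonzero_divide_eq_eq zero_neq_numeral)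
  also have "\<dots> = side n z N * side n z (Suc N)"
    by (simp add: side_def n dist_norm norm_mult norm_minus_commute flip: complex_cnj_diff)
  also have "\<dots> \<le> circumference n z * circumference n z"
    unfolding circumference_def
    by (intro mult_mono member_le_sum sum_nonneg) (auto simp: side_nonneg n)
  finally have "tri_area ?b ?c ?d \<le> (circumference n z)\<^sup>2"
    by (simp add: power2_eq_square) (smt (verit) mult_nonneg_nonneg circumference_nonneg)
  moreover have "shoelace (Suc N) z \<le> m * (circumference n z)\<^sup>2"
    using IH[of z] circumference_remove_last[of N z] n m
      mult_left_mono[OF power_mono[of "circumference (Suc N) z" "circumference n z" 2], of m]
      circumference_nonneg[of "Suc N" z] by force
  ultimately show ?thesis using shoelace_remove_last[of N z] n by (simp add: algebra_simps)
qed

lemma penalized_bounded_below: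
  "\<exists>B. \<forall>z. penalized z \<ge> - B * (circumference n z)\<^sup>2"
proof (intro exI allI)
  fix z
  have "4 * real n * tan (pi / real n) * shoelace n z \<le> 4 * real n * tan (pi / real n) * ((m + 1) * (circumference n z)\<^sup>2)"
    using shoelace_le_crude[of z] tan_pos by (intro mult_left_mono) auto
  moreover have "kappa * side_spread n z \<le> kappa * (real n * (circumference n z)\<^sup>2)"
    using side_spread_le kappa_pos by (intro mult_left_mono) auto
  ultimately show "penalized z \<ge> - (4 * real n * tan (pi / real n) * (m + 1) + kappa * real n) * (circumference n z)\<^sup>2"
    unfolding penalized_def signed_deficit_def
    by (simp add: algebra_simps) (smt (verit) zero_le_power2)
qed

text \<open>
  The penalized deficit is multiplied by this factor in one equalizing move: the move gains
  \<open>gap / 8\<close> times the square of the largest difference of adjacent sides, while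
  \<open>(1 + kappa) * n^4\<close> times that square bounds the negative of the penalized deficit.
\<close>

definition "growth = 1 + gap / (8 * (1 + kappa) * real n ^ 4)"

lemma growth_gt: "growth > 1"
  using gap_pos kappa_pos n unfolding growth_def by (simp del: of_nat_Suc)

text \<open>
  Choose a vertex whose two sides differ most and rotate the numbering so that it comes last. If the
  angle there is almost straight, deleting the vertex shows that the penalized deficit is not negative.
  Otherwise equalize the two sides.
\<close>

lemma penalized_improve:
  assumes neg: "penalized z < 0"
  shows "\<exists>z'. circumference n z' = circumference n z \<and> penalized z' \<le> growth * penalized z"
proof -
  have n0: "n > 0" and n3: "n \<ge> 3" using n N by auto
  obtain i where i: "i < n" "side_spread n z \<le> real n ^ 4 * (side n z (Suc i mod n) - side n z i)\<^sup>2"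
    using cyclic_variance_le_step[OF n0, of "side n z"] by (auto simp: side_spread_def energy_def circumference_def)
  \<comment> \<open>Shifting by \<open>i + 2\<close> moves the vertex between the sides \<open>i\<close> and \<open>i + 1\<close> to the last index \<open>N + 1\<close>.\<close>
  define y where "y = (\<lambda>k. z ((k + (i + 2)) mod n))"
  have y: "circumference n y = circumference n z" "energy n y = energy n z" "shoelace n y = shoelace n z"
    using n0 by (simp_all only: y_def circumference_rotate energy_rotate shoelace_rotate)
  then have py: "penalized y = penalized z" "side_spread n y = side_spread n z"
    by (simp_all add: penalized_def signed_deficit_def side_spread_def)
  define s where "s = side n y N + side n y (Suc N)"
  define t where "t = side n y (Suc N) - side n y N"
  define e where "e = dist (y N) (y 0)"
  define K where "K = real n * tan (pi / real n)"
  \<comment> \<open>Deleting a vertex that is straight up to \<open>k\<close> then costs half of the gap.\<close>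
  define k where "k = gap / (2 * K)"
  have K: "K > 0" using tan_pos n0 by (simp add: K_def)
  have k: "k > 0" using gap_pos K by (simp add: k_def)
  have "(N + (i + 2)) mod n = i" "(Suc N + (i + 2)) mod n = Suc i mod n"
  proof -
    have "N + (i + 2) = i + n" "Suc N + (i + 2) = Suc i + n" using n by auto
    then show "(N + (i + 2)) mod n = i" "(Suc N + (i + 2)) mod n = Suc i mod n" using i(1) by (simp_all only: mod_add_self2 mod_less)
  qed
  then have "t = side n z (Suc i mod n) - side n z i"
    unfolding t_def y_def side_rotate[OF n0] by simp
  then have spread: "side_spread n z \<le> real n ^ 4 * t\<^sup>2" using i(2) by simp
  have pen: "- penalized z \<le> (1 + kappa) * side_spread n z"
    using signed_deficit_ge_spread[OF n3, of z] by (simp add: penalized_def algebra_simps)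
  have pen_t: "- penalized z * gap / (8 * (1 + kappa) * real n ^ 4) \<le> gap * t\<^sup>2 / 8"
  proof -
    have "- penalized z \<le> (1 + kappa) * (real n ^ 4 * t\<^sup>2)"
      using pen mult_left_mono[OF spread, of "1 + kappa"] kappa_pos by linarith
    then have "- penalized z * gap \<le> (1 + kappa) * (real n ^ 4 * t\<^sup>2) * gap"
      using gap_pos by (intro mult_right_mono) auto
    then have "- penalized z * gap / (8 * ((1 + kappa) * real n ^ 4)) \<le> (1 + kappa) * real n ^ 4 * (gap * t\<^sup>2) / (8 * ((1 + kappa) * real n ^ 4))"
      using kappa_pos by (intro divide_right_mono) (auto simp: mult_ac)
    also have "\<dots> = gap * t\<^sup>2 / 8" using kappa_pos n0 by simp
    finally show ?thesis by (simp only: mult.assoc)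
  qed
  show ?thesis
  proof (cases "sqrt (s\<^sup>2 - e\<^sup>2) \<le> k * e")
    case True
    then have "shoelace n y \<le> (m + k / 4) * (circumference n y)\<^sup>2"
      using shoelace_le_flat[of k y] k by (simp add: s_def e_def)
    then have "4 * K * shoelace n y \<le> 4 * K * ((m + k / 4) * (circumference n y)\<^sup>2)"
      using K by (intro mult_left_mono) auto
    also have "\<dots> = (1 - gap / 2) * (circumference n y)\<^sup>2"
      using K by (simp add: k_def gap_def flip: K_def) (simp add: field_simps)
    finally have 1: "signed_deficit n y \<ge> gap / 2 * (circumference n y)\<^sup>2"
      by (simp add: signed_deficit_def K_def algebra_simps)
    have "kappa * side_spread n y \<le> kappa * (real n * (circumference n y)\<^sup>2)"
      using side_spread_le kappa_pos by (intro mult_left_mono) auto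
    also have "\<dots> = gap / 4 * (circumference n y)\<^sup>2"
      using n0 by (simp add: kappa_def)
    also have "\<dots> \<le> gap / 2 * (circumference n y)\<^sup>2" using gap_pos by (intro mult_right_mono) auto
    finally have "penalized y \<ge> 0" using 1 by (simp add: penalized_def)
    then show ?thesis using neg py by simp
  next
    case False
    have "side_spread n z > 0"
      using neg pen kappa_pos by (smt (verit) mult_nonneg_nonpos)
    then have "t \<noteq> 0" using spread by auto
    then have "e > 0"
      using tri_area_le(2)[where b = "y N" and c = "y (Suc N)" and d = "y 0"]
      by (auto simp: t_def e_def side_def n)
    obtain y' where y': "circumference n y' = circumference n y" "energy n y' = energy n y - t\<^sup>2 / 2"
       "shoelace n y' \<ge> shoelace n y + k * t\<^sup>2 / 8"
      using equalize_last_sides[OF N, of k y] False k \<open>e > 0\<close> by (auto simp: s_def t_def e_def n)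
    have "4 * K * shoelace n y' \<ge> 4 * K * (shoelace n y + k * t\<^sup>2 / 8)"
      using y'(3) K by (intro mult_left_mono) auto
    also have "4 * K * (shoelace n y + k * t\<^sup>2 / 8) = 4 * K * shoelace n y + gap * t\<^sup>2 / 4"
      using K by (simp add: k_def field_simps)
    finally have "signed_deficit n y' \<le> signed_deficit n y - gap * t\<^sup>2 / 4"
      using y'(1) by (simp add: signed_deficit_def K_def mult_ac)
    moreover have "kappa * side_spread n y' = kappa * side_spread n y - gap * t\<^sup>2 / 8"
    proof -
      have "side_spread n y' = side_spread n y - real n * t\<^sup>2 / 2"
        using y' by (simp add: side_spread_def right_diff_distrib)
      then show ?thesis using n0 by (simp add: kappa_def right_diff_distrib)
    qed
    ultimately have "penalized y' \<le> penalized y - gap * t\<^sup>2 / 8"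
      by (simp add: penalized_def)
    also have "\<dots> \<le> growth * penalized z"
      using pen_t py by (simp add: growth_def algebra_simps)
    finally show ?thesis using y' y by auto
  qed
qed

text \<open>
  Iterating the improvement with fixed length would push a negative value below every bound.
\<close>

lemma penalized_nonneg: "penalized z \<ge> 0"
proof (rule ccontr)
  assume "\<not> penalized z \<ge> 0"
  then have neg: "penalized z < 0" by simp
  have iter: "\<exists>y. circumference n y = circumference n z \<and> penalized y \<le> growth ^ j * penalized z" for j
  proof (induction j)
    case 0 then show ?case by (intro exI[of _ z]) simp
  next
    case (Suc j)
    then obtain y where y: "circumference n y = circumference n z" "penalized y \<le> growth ^ j * penalized z" by blast
    have "growth ^ j * penalized z < 0" using neg growth_gt by (intro mult_pos_neg) auto
    with y have "penalized y < 0" by simp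
    from penalized_improve[OF this] obtain y' where
      "circumference n y' = circumference n y" "penalized y' \<le> growth * penalized y" by blast
    moreover have "growth * penalized y \<le> growth * (growth ^ j * penalized z)"
      using y growth_gt by (intro mult_left_mono) auto
    ultimately show ?case using y by (intro exI[of _ y']) simp
  qed
  obtain B where B: "\<And>z. penalized z \<ge> - B * (circumference n z)\<^sup>2" using penalized_bounded_below by blast
  obtain j where j: "B * (circumference n z)\<^sup>2 / (- penalized z) < growth ^ j"
    using real_arch_pow[OF growth_gt] by blast
  obtain y where y: "circumference n y = circumference n z" "penalized y \<le> growth ^ j * penalized z"
    using iter by blast
  have "B * (circumference n z)\<^sup>2 < growth ^ j * (- penalized z)"
    using j neg pos_divide_less_eq[of "- penalized z"] by simp
  moreover have "- B * (circumference n z)\<^sup>2 \<le> growth ^ j * penalized z"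
    using B[of y] y by simp
  ultimately show False by simp
qed

lemma spread_le_deficit_step: "\<exists>k>0. \<forall>z. k * side_spread n z \<le> signed_deficit n z"
  using penalized_nonneg kappa_pos by (auto simp: penalized_def)

end

text \<open>
  The polygonal isoperimetric inequality for \<open>n\<close> vertices, stated with room to spare for
  \<open>n + 1\<close> vertices, which is the form in which the induction uses it. Polygons with two vertices enclose
  no area and start the induction with \<open>m = 0\<close>.
\<close>

lemma shoelace_le_circumference_strict:
  assumes "n \<ge> 2"
  shows "\<exists>m\<ge>0. 4 * (real (Suc n) * tan (pi / real (Suc n))) * m < 1 \<and>
    (\<forall>z. shoelace n z \<le> m * (circumference n z)\<^sup>2)"
  using assms
proof (induction n rule: dec_induct)
  case base
  have "shoelace 2 z = 0" for z
    by (simp add: shoelace_def numeral_2_eq_2 lessThan_Suc)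
  then show ?case by (intro exI[of _ 0]) simp
next
  case (step n)
  then obtain m where m: "m \<ge> 0" "4 * (real (Suc n) * tan (pi / real (Suc n))) * m < 1"
    "\<And>z. shoelace n z \<le> m * (circumference n z)\<^sup>2" by blast
  obtain N where N: "n = Suc N" "N \<ge> 1" using step by (cases n) auto
  obtain k where k: "k > 0" "\<And>z. k * side_spread (Suc n) z \<le> signed_deficit (Suc n) z"
    using spread_le_deficit_step[OF N(2) refl m(1)] m unfolding N(1) by blast
  define K where "K = real (Suc n) * tan (pi / real (Suc n))"
  have K: "K > 0" using tan_pi_div_pos[of "Suc n"] step by (simp add: K_def)
  have "shoelace (Suc n) z \<le> 1 / (4 * K) * (circumference (Suc n) z)\<^sup>2" for z
  proof -
    have "0 \<le> k * side_spread (Suc n) z" using k side_spread_nonneg by simp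
    also have "\<dots> \<le> (circumference (Suc n) z)\<^sup>2 - 4 * K * shoelace (Suc n) z"
      using k(2)[of z] by (simp only: signed_deficit_def K_def mult.assoc)
    finally have "4 * K * shoelace (Suc n) z \<le> (circumference (Suc n) z)\<^sup>2" by simp
    then show ?thesis using K by (simp add: field_simps)
  qed
  moreover have "4 * (real (Suc (Suc n)) * tan (pi / real (Suc (Suc n)))) * (1 / (4 * K)) < 1"
    using n_tan_pi_div_decreasing[of "Suc n"] step K by (simp add: K_def)
  ultimately show ?case using K by (intro exI[of _ "1 / (4 * K)"]) auto
qed

theorem side_spread_le_deficit:
  assumes "n \<ge> 3"
  shows "\<exists>k>0. \<forall>z. k * side_spread n z \<le> signed_deficit n z"
proof -
  obtain N where N: "n = Suc (Suc N)" "N \<ge> 1"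
    using assms by (metis One_nat_def Suc_le_D Suc_le_mono numeral_3_eq_3)
  obtain m where "m \<ge> 0" "4 * (real n * tan (pi / real n)) * m < 1"
    "\<And>z. shoelace (Suc N) z \<le> m * (circumference (Suc N) z)\<^sup>2"
    using shoelace_le_circumference_strict[of "Suc N"] N by auto
  then show ?thesis using spread_le_deficit_step[OF N(2,1)] by blast
qed

section \<open>From near-regularity to radii and central angles\<close>

text \<open>
  The form \<open>Q = energy - 4 tan (pi / n) shoelace\<close> satisfies \<open>n Q = signed_deficit + side_spread\<close>, and
  the side spread is at most a multiple of the signed deficit.
\<close>

lemma near_regular:
  assumes "n \<ge> 3"
  shows "\<exists>c>0. \<forall>z. (\<Sum>k<n. z k) = 0 \<longrightarrow>
    (\<exists>a. (\<Sum>k<n. (cmod (z k - a * primroot n ^ k))\<^sup>2) \<le> c * signed_deficit n z)"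
proof -
  obtain l where l: "l > 0" "\<And>z. (\<Sum>k<n. z k) = 0 \<Longrightarrow>
    l * (\<Sum>k<n. (cmod (z k - dft n z 1 * primroot n ^ k))\<^sup>2)
      \<le> energy n z - 4 * tan (pi / real n) * shoelace n z"
    using energy_excess_coercive[OF assms] by blast
  obtain \<kappa> where k: "\<kappa> > 0" "\<And>z. \<kappa> * side_spread n z \<le> signed_deficit n z"
    using side_spread_le_deficit[OF assms] by blast
  define c where "c = (1 + 1 / \<kappa>) / (real n * l)"
  have n: "real n > 0" using assms by simp
  have "c > 0" using l k n by (simp add: c_def add_pos_pos)
  moreover have "(\<Sum>k<n. (cmod (z k - dft n z 1 * primroot n ^ k))\<^sup>2) \<le> c * signed_deficit n z"
    if z: "(\<Sum>k<n. z k) = 0" for z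
  proof -
    let ?E = "\<Sum>k<n. (cmod (z k - dft n z 1 * primroot n ^ k))\<^sup>2"
    have "real n * (l * ?E) \<le> real n * (energy n z - 4 * tan (pi / real n) * shoelace n z)"
      using l(2)[OF z] n by (intro mult_left_mono) auto
    also have "\<dots> = signed_deficit n z + side_spread n z"
      by (simp add: signed_deficit_def side_spread_def algebra_simps)
    also have "\<dots> \<le> (1 + 1 / \<kappa>) * signed_deficit n z"
      using k(2)[of z] k(1) by (simp add: field_simps)
    finally show ?thesis using n l(1) by (simp add: c_def pos_le_divide_eq mult_ac)
  qed
  ultimately show ?thesis by blast
qed

text \<open>
  The mean square deviation from \<open>c\<close> exceeds the variance by the squared distance of \<open>c\<close> to the mean.
  So a comparison value such as \<open>2 * pi / n\<close> may be used in place of the mean.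
\<close>

lemma family_variance_eq:
  assumes "n > 0"
  shows "family_variance n f = (1 / real n) * (\<Sum>i<n. (f i - c)\<^sup>2) - ((\<Sum>i<n. f i) / real n - c)\<^sup>2"
proof -
  have "(\<Sum>i<n. (f i - c)\<^sup>2) = (\<Sum>i<n. (f i)\<^sup>2) + real n * c\<^sup>2 - 2 * c * (\<Sum>i<n. f i)"
    by (simp add: power2_diff sum.distrib sum_subtractf sum_distrib_left mult_ac)
  then show ?thesis
    using assms by (simp only: family_variance_def) (simp add: power2_diff power_divide field_simps power2_eq_square)
qed

lemma family_variance_le:
  "n > 0 \<Longrightarrow> family_variance n f \<le> (1 / real n) * (\<Sum>i<n. (f i - c)\<^sup>2)"
  by (subst family_variance_eq[of n f c]) auto

lemma abs_le_3_abs_sin: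
  fixes v :: real
  assumes "\<bar>v\<bar> \<le> 2" shows "\<bar>v\<bar> \<le> 3 * \<bar>sin v\<bar>"
proof -
  have "\<bar>sin v - v\<bar> \<le> \<bar>v\<bar> ^ 3 / 6"
    using Maclaurin_sin_bound[of v 3] by (simp add: numeral_3_eq_3 sin_coeff_def fact_numeral)
  also have "\<bar>v\<bar> ^ 3 = \<bar>v\<bar> ^ 2 * \<bar>v\<bar>" by (simp add: power3_eq_cube power2_eq_square)
  also have "\<dots> / 6 \<le> 2\<^sup>2 * \<bar>v\<bar> / 6"
    using assms by (intro divide_right_mono mult_right_mono power_mono) auto
  finally show ?thesis by (simp add: abs_if split: if_splits)
qed

text \<open>
  At the ends of its domain \<open>arccos\<close> has infinite slope, but a Lipschitz bound with one fixed interior point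
  \<open>t\<close> holds on the whole domain: in
  \<open>cos t - cos x = 2 sin ((x + t) / 2) sin ((x - t) / 2)\<close> the first sine is bounded below for all
  \<open>x\<close> in \<open>[0, pi]\<close>.
\<close>

lemma arccos_lipschitz_at:
  assumes "0 < t" "t < pi"
  shows "\<exists>C>0. \<forall>y. \<bar>y\<bar> \<le> 1 \<longrightarrow> \<bar>arccos y - t\<bar> \<le> C * \<bar>y - cos t\<bar>"
proof -
  define s where "s = min (sin (t / 2)) (cos (t / 2))"
  have s: "s > 0" unfolding s_def using assms
    by (auto intro!: sin_gt_zero cos_gt_zero)
  have "\<bar>arccos y - t\<bar> \<le> 3 / s * \<bar>y - cos t\<bar>" if "\<bar>y\<bar> \<le> 1" for y
  proof -
    define x where "x = arccos y"
    have x: "0 \<le> x" "x \<le> pi" "cos x = y" using that by (auto simp: x_def abs_le_iff arccos_lbound arccos_ubound cos_arccos)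
    have sin_ge: "sin ((x + t) / 2) \<ge> s"
    proof (cases "(x + t) / 2 \<le> pi / 2")
      case True
      then have "sin (t / 2) \<le> sin ((x + t) / 2)" using x assms by (intro sin_monotone_2pi_le) auto
      then show ?thesis by (simp add: s_def)
    next
      case False
      have "sin (pi / 2 - t / 2) \<le> sin (pi - (x + t) / 2)"
        using x(1,2) assms False by (intro sin_monotone_2pi_le) (simp_all add: field_simps)
      moreover have "sin (pi / 2 - t / 2) = cos (t / 2)" by (simp add: sin_diff)
      ultimately have "cos (t / 2) \<le> sin ((x + t) / 2)" by (simp only: sin_pi_minus)
      then show ?thesis by (simp add: s_def)
    qed
    have "\<bar>(x - t) / 2\<bar> \<le> 2"
      using x(1,2) assms pi_less_4 unfolding abs_le_iff by (simp add: field_simps)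
    from abs_le_3_abs_sin[OF this] have "\<bar>x - t\<bar> \<le> 6 * \<bar>sin ((x - t) / 2)\<bar>" by simp
    then have "s * \<bar>x - t\<bar> \<le> 6 * (s * \<bar>sin ((x - t) / 2)\<bar>)"
      using mult_left_mono[of "\<bar>x - t\<bar>" _ s] s by fastforce
    also have "\<dots> \<le> 6 * (sin ((x + t) / 2) * \<bar>sin ((x - t) / 2)\<bar>)"
      using sin_ge by (intro mult_left_mono mult_right_mono) auto
    also have "\<dots> = 3 * \<bar>cos x - cos t\<bar>"
    proof -
      have "\<bar>sin ((t - x) / 2)\<bar> = \<bar>sin ((x - t) / 2)\<bar>"
        using sin_minus[of "(x - t) / 2"] by (simp add: minus_divide_left)
      then show ?thesis using s sin_ge by (simp add: cos_diff_cos abs_mult)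
    qed
    finally show ?thesis using s x by (simp add: x_def field_simps)
  qed
  moreover have "3 / s > 0" using s by simp
  ultimately show ?thesis by blast
qed

lemma norm_sgn_diff_le:
  fixes x y :: "'a :: real_normed_vector"
  assumes "y \<noteq> 0" shows "norm (sgn x - sgn y) \<le> 2 * norm (x - y) / norm y"
proof (cases "x = 0")
  case True then show ?thesis using assms by (simp add: norm_sgn)
next
  case False
  have "norm y *\<^sub>R (sgn x - sgn y) = (x - y) + (norm y - norm x) *\<^sub>R sgn x"
    using assms False by (simp add: sgn_div_norm scaleR_diff_right scaleR_diff_left left_diff_distrib)
  then have "norm (norm y *\<^sub>R (sgn x - sgn y)) \<le> norm (x - y) + norm ((norm y - norm x) *\<^sub>R sgn x)"
    by (simp only: norm_triangle_ineq)
  then have "norm y * norm (sgn x - sgn y) \<le> norm (x - y) + \<bar>norm y - norm x\<bar>"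
    using False by (simp add: norm_sgn)
  also have "\<dots> \<le> 2 * norm (x - y)"
    using norm_triangle_ineq3[of y x] by (simp add: norm_minus_commute)
  finally show ?thesis using assms by (simp add: field_simps)
qed

text \<open>
  The unoriented angle. In terms of directions, the deviation of an angle is controlled by that of \<open>sgn u\<close> and
  \<open>sgn v\<close>, without a case distinction on whether one of the vectors vanishes.
\<close>

definition cangle :: "complex \<Rightarrow> complex \<Rightarrow> real" where
  "cangle u v = arccos (inner (sgn u) (sgn v))"

lemma abs_inner_sgn_le: "\<bar>inner (sgn u) (sgn v)\<bar> \<le> (1::real)"
proof -
  have "\<bar>inner (sgn u) (sgn v)\<bar> \<le> norm (sgn u) * norm (sgn v)" by (rule Cauchy_Schwarz_ineq2)
  also have "\<dots> \<le> 1" by (simp add: norm_sgn)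
  finally show ?thesis .
qed

lemma cangle_bounds: "0 \<le> cangle u v" "cangle u v \<le> pi"
  using abs_inner_sgn_le[of u v] by (auto simp: cangle_def abs_le_iff intro!: arccos_lbound arccos_ubound)

text \<open>
  The directions of \<open>z k\<close> and of the regular vertex \<open>a * primroot n ^ k\<close> differ by at most twice the
  distance of the two points divided by \<open>|a|\<close>, and the cosine of the angle is bilinear in the directions. The
  bound holds for all \<open>z\<close>, near to a regular polygon or not.
\<close>

lemma central_angle_deviation:
  assumes "n \<ge> 3"
  shows "\<exists>C>0. \<forall>z a k. a \<noteq> 0 \<longrightarrow> \<bar>cangle (z k) (z (Suc k mod n)) - 2 * pi / real n\<bar>
    \<le> C * (cmod (z k - a * primroot n ^ k) + cmod (z (Suc k mod n) - a * primroot n ^ (Suc k mod n))) / cmod a"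
proof -
  have t: "0 < 2 * pi / real n" "2 * pi / real n < pi" using assms by (auto simp: field_simps)
  obtain C where C: "C > 0" "\<And>y. \<bar>y\<bar> \<le> 1 \<Longrightarrow> \<bar>arccos y - 2 * pi / real n\<bar> \<le> C * \<bar>y - cos (2 * pi / real n)\<bar>"
    using arccos_lipschitz_at[OF t] by blast
  have "\<bar>cangle (z k) (z (Suc k mod n)) - 2 * pi / real n\<bar>
    \<le> (2 * C) * (cmod (z k - a * primroot n ^ k) + cmod (z (Suc k mod n) - a * primroot n ^ (Suc k mod n))) / cmod a"
    if a: "a \<noteq> 0" for z a k
  proof -
    define u where "u = sgn (z k)"
    define v where "v = sgn (z (Suc k mod n))"
    define p where "p = sgn (a * primroot n ^ k)"
    define q where "q = sgn (a * primroot n ^ (Suc k mod n))"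
    have w: "primroot n \<noteq> 0" by (simp add: primroot_def)
    have up: "cmod (u - p) \<le> 2 * cmod (z k - a * primroot n ^ k) / cmod a"
      using norm_sgn_diff_le[of "a * primroot n ^ k" "z k"] a w
      by (simp add: u_def p_def norm_mult cmod_primroot_power)
    have vq: "cmod (v - q) \<le> 2 * cmod (z (Suc k mod n) - a * primroot n ^ (Suc k mod n)) / cmod a"
      using norm_sgn_diff_le[of "a * primroot n ^ (Suc k mod n)" "z (Suc k mod n)"] a w
      by (simp add: v_def q_def norm_mult cmod_primroot_power)
    have n: "cmod v \<le> 1" "cmod p \<le> 1" by (simp_all add: v_def p_def norm_sgn)
    have pq: "inner p q = cos (2 * pi / real n)"
    proof -
      have unit: "sgn (primroot n ^ j) = primroot n ^ j" for j
        by (simp add: sgn_eq cmod_primroot_power)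
      have "p = sgn a * primroot n ^ k" "q = primroot n * p"
        using unit[of 1] assms by (simp_all add: unit p_def q_def sgn_mult primroot_power_Suc_mod mult_ac)
      then have "inner p q = Re (primroot n) * (cmod p)\<^sup>2"
        by (simp add: inner_complex_def cmod_power2) (simp add: power2_eq_square algebra_simps)
      also have "cmod p = 1" using a w by (simp add: p_def norm_sgn)
      finally show ?thesis by (simp add: primroot_def)
    qed
    have "inner u v - inner p q = inner (u - p) v + inner p (v - q)"
      by (simp add: inner_diff_left inner_diff_right)
    also have "\<bar>\<dots>\<bar> \<le> cmod (u - p) * cmod v + cmod p * cmod (v - q)"
      by (intro order_trans[OF abs_triangle_ineq] add_mono Cauchy_Schwarz_ineq2)
    also have "\<dots> \<le> cmod (u - p) + cmod (v - q)"
      using n by (intro add_mono mult_left_le mult_left_le_one_le) auto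
    also have "\<dots> \<le> 2 * (cmod (z k - a * primroot n ^ k) + cmod (z (Suc k mod n) - a * primroot n ^ (Suc k mod n))) / cmod a"
      using up vq by (simp add: add_divide_distrib distrib_left)
    finally have "C * \<bar>inner u v - inner p q\<bar> \<le> C * (2 * (cmod (z k - a * primroot n ^ k) + cmod (z (Suc k mod n) - a * primroot n ^ (Suc k mod n))) / cmod a)"
      using C(1) by (intro mult_left_mono) auto
    moreover have "\<bar>cangle (z k) (z (Suc k mod n)) - 2 * pi / real n\<bar> \<le> C * \<bar>inner u v - inner p q\<bar>"
      unfolding pq cangle_def u_def v_def by (intro C(2) abs_inner_sgn_le)
    ultimately show ?thesis by (simp add: mult_ac)
  qed
  then show ?thesis using C(1) by (intro exI[of _ "2 * C"]) auto
qed

lemma shoelace_le_energy: "n \<ge> 3 \<Longrightarrow> shoelace n z \<le> energy n z / (4 * tan (pi / real n))"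
  using energy_excess_nonneg[of n z] tan_pi_div_pos[of n] by (simp add: field_simps)

lemma sum_power2_le_deviation:
  "(\<Sum>k<n. (cmod (z k))\<^sup>2) \<le> 2 * (real n * (cmod a)\<^sup>2 + (\<Sum>k<n. (cmod (z k - a * primroot n ^ k))\<^sup>2))"
proof -
  have "(cmod (z k))\<^sup>2 \<le> 2 * (cmod a)\<^sup>2 + 2 * (cmod (z k - a * primroot n ^ k))\<^sup>2" for k
  proof -
    have "cmod (z k) \<le> cmod a + cmod (z k - a * primroot n ^ k)"
      using norm_triangle_ineq[of "a * primroot n ^ k" "z k - a * primroot n ^ k"]
      by (simp add: norm_mult cmod_primroot_power)
    then have "(cmod (z k))\<^sup>2 \<le> (cmod a + cmod (z k - a * primroot n ^ k))\<^sup>2" by (intro power_mono) auto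
    also have "\<dots> \<le> 2 * (cmod a)\<^sup>2 + 2 * (cmod (z k - a * primroot n ^ k))\<^sup>2"
      using sum_squares_bound[of "cmod a" "cmod (z k - a * primroot n ^ k)"] by (simp add: power2_sum)
    finally show ?thesis .
  qed
  then have "(\<Sum>k<n. (cmod (z k))\<^sup>2) \<le> (\<Sum>k<n. 2 * (cmod a)\<^sup>2 + 2 * (cmod (z k - a * primroot n ^ k))\<^sup>2)"
    by (rule sum_mono)
  then show ?thesis by (simp add: sum.distrib sum_distrib_left)
qed

lemma energy_le_sum_power2: "energy n z \<le> 4 * (\<Sum>k<n. (cmod (z k))\<^sup>2)"
proof -
  have "(side n z k)\<^sup>2 \<le> 2 * (cmod (z k))\<^sup>2 + 2 * (cmod (z (Suc k mod n)))\<^sup>2" for k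
  proof -
    have "(side n z k)\<^sup>2 \<le> (cmod (z k) + cmod (z (Suc k mod n)))\<^sup>2"
      unfolding side_def dist_norm by (intro power_mono norm_triangle_ineq4) auto
    also have "\<dots> \<le> 2 * (cmod (z k))\<^sup>2 + 2 * (cmod (z (Suc k mod n)))\<^sup>2"
      using sum_squares_bound[of "cmod (z k)" "cmod (z (Suc k mod n))"] by (simp add: power2_sum)
    finally show ?thesis .
  qed
  then have "energy n z \<le> (\<Sum>k<n. 2 * (cmod (z k))\<^sup>2 + 2 * (cmod (z (Suc k mod n)))\<^sup>2)"
    unfolding energy_def by (rule sum_mono)
  then show ?thesis
    using sum_cyclic_Suc[of "\<lambda>k. (cmod (z k))\<^sup>2" n] by (simp add: sum.distrib flip: sum_distrib_left)
qed

text \<open>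
  Let \<open>E\<close> be the squared distance of \<open>z\<close> to a regular polygon with radius \<open>|a|\<close>. The area is at most
  a multiple of \<open>|a|^2 + E\<close>. If \<open>E\<close> dominates, it is enough that angles are bounded by \<open>pi\<close>; if \<open>|a|^2\<close>
  dominates, the variance of the angles is at most a multiple of \<open>E / |a|^2\<close>. In both cases the product
  is at most a multiple of \<open>E\<close>, hence of the deficit.
\<close>

theorem variances_le_signed_deficit:
  assumes "n \<ge> 3"
  shows "\<exists>c>0. \<forall>z S. (\<Sum>k<n. z k) = 0 \<and> 0 \<le> S \<and> S \<le> shoelace n z \<longrightarrow>
    family_variance n (\<lambda>k. cmod (z k)) + S * family_variance n (\<lambda>k. cangle (z k) (z (Suc k mod n)))
      \<le> c * signed_deficit n z"
proof -
  obtain c where c: "c > 0" "\<And>z. (\<Sum>k<n. z k) = 0 \<Longrightarrow>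
    (\<exists>a. (\<Sum>k<n. (cmod (z k - a * primroot n ^ k))\<^sup>2) \<le> c * signed_deficit n z)"
    using near_regular[OF assms] by blast
  obtain C where C: "C > 0" "\<And>z a k. a \<noteq> 0 \<Longrightarrow> \<bar>cangle (z k) (z (Suc k mod n)) - 2 * pi / real n\<bar>
    \<le> C * (cmod (z k - a * primroot n ^ k) + cmod (z (Suc k mod n) - a * primroot n ^ (Suc k mod n))) / cmod a"
    using central_angle_deviation[OF assms] by blast
  define B where "B = 2 * real n / tan (pi / real n)"
  have n: "real n \<ge> 1" "n > 0" using assms by auto
  have B: "B > 0" using tan_pi_div_pos[OF assms] n by (simp add: B_def)
  define M where "M = 1 + 2 * B * pi\<^sup>2 + 8 * B * C\<^sup>2"
  have M: "M > 0" using B by (simp add: M_def add_pos_nonneg)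
  have "family_variance n (\<lambda>k. cmod (z k)) + S * family_variance n (\<lambda>k. cangle (z k) (z (Suc k mod n)))
      \<le> (M * c) * signed_deficit n z"
    if z: "(\<Sum>k<n. z k) = 0" "0 \<le> S" "S \<le> shoelace n z" for z S
  proof -
    obtain a where a: "(\<Sum>k<n. (cmod (z k - a * primroot n ^ k))\<^sup>2) \<le> c * signed_deficit n z"
      using c(2)[OF z(1)] by blast
    define d where "d k = cmod (z k - a * primroot n ^ k)" for k
    define E where "E = (\<Sum>k<n. (d k)\<^sup>2)"
    have E: "E \<ge> 0" by (simp add: E_def sum_nonneg)
    let ?V = "family_variance n (\<lambda>k. cangle (z k) (z (Suc k mod n)))"
    have En: "(1 / real n) * E \<le> E" using E n by (intro mult_left_le_one_le) auto
    have "family_variance n (\<lambda>k. cmod (z k)) \<le> (1 / real n) * (\<Sum>k<n. (cmod (z k) - cmod a)\<^sup>2)"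
      by (rule family_variance_le[OF n(2)])
    also have "\<dots> \<le> (1 / real n) * E"
      unfolding E_def
    proof (intro mult_left_mono sum_mono)
      fix k
      have "\<bar>cmod (z k) - cmod a\<bar> \<le> d k"
        using norm_triangle_ineq3[of "z k" "a * primroot n ^ k"] by (simp add: d_def norm_mult cmod_primroot_power)
      then show "(cmod (z k) - cmod a)\<^sup>2 \<le> (d k)\<^sup>2" using power_mono[of _ "d k" 2] by fastforce
    qed simp
    finally have radii: "family_variance n (\<lambda>k. cmod (z k)) \<le> E" using En by linarith
    have "S \<le> energy n z / (4 * tan (pi / real n))"
      using z(3) shoelace_le_energy[OF assms, of z] by linarith
    also have "\<dots> \<le> (4 * (2 * (real n * (cmod a)\<^sup>2 + E))) / (4 * tan (pi / real n))"
      using energy_le_sum_power2[of n z] sum_power2_le_deviation[of z n a] tan_pi_div_pos[OF assms]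
      by (intro divide_right_mono) (auto simp: E_def d_def)
    also have "\<dots> \<le> (4 * (2 * (real n * ((cmod a)\<^sup>2 + E)))) / (4 * tan (pi / real n))"
      using n E tan_pi_div_pos[OF assms] mult_right_mono[of 1 "real n" E]
      by (intro divide_right_mono) (auto simp: distrib_left)
    also have "\<dots> = B * ((cmod a)\<^sup>2 + E)"
      by (simp add: B_def)
    finally have S: "S \<le> B * ((cmod a)\<^sup>2 + E)" .
    have angles: "S * ?V \<le> (2 * B * pi\<^sup>2 + 8 * B * C\<^sup>2) * E"
    proof (cases "(cmod a)\<^sup>2 \<le> E")
      case True
      have "?V \<le> (1 / real n) * (\<Sum>k<n. (cangle (z k) (z (Suc k mod n)) - 0)\<^sup>2)"
        by (rule family_variance_le[OF n(2)])
      also have "\<dots> \<le> (1 / real n) * (\<Sum>k<n. pi\<^sup>2)"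
        using cangle_bounds by (intro mult_left_mono sum_mono power_mono) auto
      also have "\<dots> = pi\<^sup>2" using n by simp
      finally have "S * ?V \<le> S * pi\<^sup>2" using z(2) by (rule mult_left_mono)
      also have "\<dots> \<le> (B * (2 * E)) * pi\<^sup>2"
        using S True B mult_left_mono[of "(cmod a)\<^sup>2 + E" "2 * E" B] by (intro mult_right_mono) (linarith, simp)
      also have "\<dots> \<le> (2 * B * pi\<^sup>2 + 8 * B * C\<^sup>2) * E"
        using B E by (simp add: algebra_simps)
      finally show ?thesis .
    next
      case False
      then have a0: "a \<noteq> 0" using E by auto
      have "?V \<le> (1 / real n) * (\<Sum>k<n. (cangle (z k) (z (Suc k mod n)) - 2 * pi / real n)\<^sup>2)"
        by (rule family_variance_le[OF n(2)])
      also have "\<dots> \<le> (1 / real n) * (\<Sum>k<n. 2 * C\<^sup>2 / (cmod a)\<^sup>2 * ((d k)\<^sup>2 + (d (Suc k mod n))\<^sup>2))"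
      proof (intro mult_left_mono sum_mono)
        fix k
        have "\<bar>cangle (z k) (z (Suc k mod n)) - 2 * pi / real n\<bar> \<le> C * (d k + d (Suc k mod n)) / cmod a"
          using C(2)[OF a0] by (simp add: d_def)
        then have "(cangle (z k) (z (Suc k mod n)) - 2 * pi / real n)\<^sup>2 \<le> (C * (d k + d (Suc k mod n)) / cmod a)\<^sup>2"
          using power_mono[of _ "C * (d k + d (Suc k mod n)) / cmod a" 2] by fastforce
        also have "\<dots> = C\<^sup>2 / (cmod a)\<^sup>2 * (d k + d (Suc k mod n))\<^sup>2"
          by (simp add: power_mult_distrib power_divide)
        also have "\<dots> \<le> C\<^sup>2 / (cmod a)\<^sup>2 * (2 * ((d k)\<^sup>2 + (d (Suc k mod n))\<^sup>2))"
          using sum_squares_bound[of "d k" "d (Suc k mod n)"] by (intro mult_left_mono) (auto simp: power2_sum)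
        finally show "(cangle (z k) (z (Suc k mod n)) - 2 * pi / real n)\<^sup>2 \<le> 2 * C\<^sup>2 / (cmod a)\<^sup>2 * ((d k)\<^sup>2 + (d (Suc k mod n))\<^sup>2)"
          by (simp add: distrib_left add_divide_distrib mult_ac)
      qed simp
      also have "\<dots> = (1 / real n) * (4 * C\<^sup>2 / (cmod a)\<^sup>2 * E)"
        unfolding sum_distrib_left[symmetric] sum.distrib sum_cyclic_Suc[of "\<lambda>k. (d k)\<^sup>2" n] E_def by simp
      also have "\<dots> \<le> 4 * C\<^sup>2 / (cmod a)\<^sup>2 * E"
        using E n by (intro mult_left_le_one_le) auto
      finally have "S * ?V \<le> S * (4 * C\<^sup>2 / (cmod a)\<^sup>2 * E)" using z(2) by (rule mult_left_mono)
      also have "\<dots> \<le> (B * (2 * (cmod a)\<^sup>2)) * (4 * C\<^sup>2 / (cmod a)\<^sup>2 * E)"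
        using S False B E mult_left_mono[of "(cmod a)\<^sup>2 + E" "2 * (cmod a)\<^sup>2" B] by (intro mult_right_mono) (linarith, simp)
      also have "\<dots> = 8 * B * C\<^sup>2 * E" using a0 by simp
      also have "\<dots> \<le> (2 * B * pi\<^sup>2 + 8 * B * C\<^sup>2) * E"
        using B E by (intro mult_right_mono) auto
      finally show ?thesis .
    qed
    have "family_variance n (\<lambda>k. cmod (z k)) + S * ?V \<le> M * E"
      using radii angles by (simp add: M_def algebra_simps)
    also have "\<dots> \<le> M * (c * signed_deficit n z)"
      using a M by (intro mult_left_mono) (auto simp: E_def d_def)
    finally show ?thesis by (simp add: mult.assoc)
  qed
  then show ?thesis using M c(1) by (intro exI[of _ "M * c"]) auto
qed

section \<open>Geometry of convex polygons\<close>

definition to_complex :: "real^2 \<Rightarrow> complex" where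
  "to_complex v = Complex (v $ 1) (v $ 2)"

definition cross2 :: "real^2 \<Rightarrow> real^2 \<Rightarrow> real" where
  "cross2 u v = u $ 1 * v $ 2 - u $ 2 * v $ 1"

lemma to_complex_simps:
  "to_complex (u - v) = to_complex u - to_complex v"
  "to_complex (u + v) = to_complex u + to_complex v"
  "to_complex (c *\<^sub>R v) = of_real c * to_complex v"
  "to_complex 0 = 0"
  by (simp_all add: to_complex_def complex_eq_iff)

lemma to_complex_sum: "to_complex (\<Sum>i\<in>I. f i) = (\<Sum>i\<in>I. to_complex (f i))"
  by (induction I rule: infinite_finite_induct) (simp_all add: to_complex_simps)

lemma inner_to_complex: "inner (to_complex u) (to_complex v) = inner u v"
  by (simp add: to_complex_def inner_complex_def inner_vec_def sum_2)

lemma norm_to_complex: "cmod (to_complex u) = norm u"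
  by (simp add: norm_eq_sqrt_inner inner_to_complex)

lemma dist_to_complex: "dist (to_complex u) (to_complex v) = dist u v"
  by (simp add: dist_norm norm_to_complex flip: to_complex_simps)

lemma cross2_to_complex: "Im (cnj (to_complex u) * to_complex v) = cross2 u v"
  by (simp add: to_complex_def cross2_def)

lemma vec_angle_to_complex: "vec_angle u v = cangle (to_complex u) (to_complex v)"
  by (simp add: vec_angle_def cangle_def sgn_div_norm inner_to_complex norm_to_complex divide_inverse mult_ac)

lemma cross2_simps:
  "cross2 (u + v) w = cross2 u w + cross2 v w" "cross2 u (v + w) = cross2 u v + cross2 u w"
  "cross2 (u - v) w = cross2 u w - cross2 v w" "cross2 u (v - w) = cross2 u v - cross2 u w"
  "cross2 (c *\<^sub>R u) w = c * cross2 u w" "cross2 u (c *\<^sub>R w) = c * cross2 u w"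
  "cross2 u u = 0" "cross2 u 0 = 0" "cross2 0 u = 0"
  by (simp_all add: cross2_def algebra_simps)

lemma cross2_commute: "cross2 u v = - cross2 v u"
  by (simp add: cross2_def)

lemma cross2_sum: "cross2 u (\<Sum>i\<in>I. f i) = (\<Sum>i\<in>I. cross2 u (f i))"
  by (induction I rule: infinite_finite_induct) (simp_all add: cross2_simps)

lemma area_triangle: "area (convex hull {a, b, c}) = \<bar>cross2 (b - a) (c - a)\<bar> / 2"
proof -
  have "compact (convex hull {a, b, c})" by (simp add: finite_imp_compact_convex_hull)
  then have "area (convex hull {a, b, c}) = measure lborel (convex hull {a, b, c})"
    unfolding area_def by (intro measure_completion) (auto dest: compact_imp_closed)
  then show ?thesis
    by (simp add: content_triangle cross2_def abs_minus_commute mult.commute)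
qed

text \<open>
  A face of a polytope is exposed. The normal of a line that supports the polytope along the edge is
  orthogonal to \<open>b - a\<close>, so in the plane the supporting functional is a multiple of the cross product
  with \<open>b - a\<close>.
\<close>

lemma edge_support:
  assumes "polytope P" "closed_segment a b edge_of P" "a \<noteq> b" "w \<in> P" "w \<notin> closed_segment a b"
  shows "\<exists>t. t \<noteq> 0 \<and> (\<forall>x\<in>P. t * cross2 (b - a) (x - a) \<ge> 0) \<and>
    (\<forall>x\<in>P. cross2 (b - a) (x - a) = 0 \<longrightarrow> x \<in> closed_segment a b)"
proof -
  let ?F = "closed_segment a b"
  have F: "?F face_of P" using assms by (simp add: edge_of_def)
  then have "?F exposed_face_of P"
    using assms(1) by (simp add: exposed_face_of_polyhedron polytope_imp_polyhedron)
  then obtain d c where dc: "P \<subseteq> {x. d \<bullet> x \<le> c}" "?F = P \<inter> {x. d \<bullet> x = c}"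
    unfolding exposed_face_of_def by blast
  have ab: "a \<in> P" "d \<bullet> a = c" "d \<bullet> b = c"
    using dc(2) ends_in_segment by blast+
  define j where "j = d $ 1 * (b - a) $ 2 - d $ 2 * (b - a) $ 1"
  define r where "r = ((b - a) $ 1)\<^sup>2 + ((b - a) $ 2)\<^sup>2"
  have r: "r > 0"
    using assms(3) by (auto simp: r_def vec_eq_iff forall_2 sum_power2_gt_zero_iff)
  have perp: "d $ 1 * (b - a) $ 1 + d $ 2 * (b - a) $ 2 = 0"
    using ab by (simp add: inner_vec_def sum_2 algebra_simps)
  \<comment> \<open>As \<open>d\<close> is orthogonal to \<open>b - a\<close>, it is a multiple of the rotated vector; \<open>r\<close> clears the denominator.\<close>
  have rep: "r * (d \<bullet> y) = - j * cross2 (b - a) y" for y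
  proof -
    have "r * (d \<bullet> y) + j * cross2 (b - a) y = (d $ 1 * (b - a) $ 1 + d $ 2 * (b - a) $ 2) * ((b - a) $ 1 * y $ 1 + (b - a) $ 2 * y $ 2)"
      unfolding r_def j_def cross2_def inner_vec_def sum_2 inner_real_def by algebra
    then show ?thesis using perp by simp
  qed
  have "j \<noteq> 0"
  proof
    assume "j = 0"
    then have "d \<bullet> y = 0" for y using rep[of y] r by simp
    then have "?F = P" using dc(2) ab by auto
    then show False using assms by simp
  qed
  moreover have "j * cross2 (b - a) (x - a) \<ge> 0" if "x \<in> P" for x
  proof -
    have "d \<bullet> (x - a) \<le> 0" using that dc(1) ab by (auto simp: inner_diff_right)
    then have "r * (d \<bullet> (x - a)) \<le> 0" using r by (simp add: mult_nonneg_nonpos)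
    then show ?thesis using rep by simp
  qed
  moreover have "x \<in> ?F" if "x \<in> P" "cross2 (b - a) (x - a) = 0" for x
  proof -
    have "r * (d \<bullet> (x - a)) = 0" using rep that by simp
    then have "d \<bullet> x = c" using r ab by (simp add: inner_diff_right)
    then show ?thesis using dc(2) that by blast
  qed
  ultimately show ?thesis by blast
qed

lemma Suc_mod_neq: "n \<ge> 2 \<Longrightarrow> i < n \<Longrightarrow> Suc i mod n \<noteq> i"
  by (cases "Suc i = n") auto

lemma Suc_Suc_mod_neq: "n \<ge> 3 \<Longrightarrow> i < n \<Longrightarrow> Suc (Suc i mod n) mod n \<noteq> i"
  by (cases "Suc i = n"; cases "Suc (Suc i) = n") auto

text \<open>
  The polygon lies on one side of each edge line. Two consecutive edges have it on the same side, because
  both sides are decided by the same turn: the third vertex seen from the first edge and the first vertex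
  seen from the second edge give the same cross product.
\<close>

lemma convex_ngon_orientation:
  assumes "convex_ngon n A P"
  shows "\<exists>s. \<bar>s\<bar> = 1 \<and> (\<forall>i<n. \<forall>x\<in>P. s * cross2 (A (Suc i mod n) - A i) (x - A i) \<ge> 0) \<and>
    (\<forall>i<n. s * cross2 (A (Suc i mod n) - A i) (A (Suc (Suc i mod n) mod n) - A i) > 0)"
proof -
  let ?e = "\<lambda>i. A (Suc i mod n) - A i"
  have n: "3 \<le> n" and P: "polytope P" and bij: "bij_betw A {..<n} {v. v extreme_point_of P}"
    and edge: "\<And>i. i < n \<Longrightarrow> closed_segment (A i) (A (Suc i mod n)) edge_of P"
    using assms by (auto simp: convex_ngon_def)
  have inj: "A i = A j \<longleftrightarrow> i = j" if "i < n" "j < n" for i j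
    using bij that by (auto simp: bij_betw_def inj_on_def)
  have ext: "A i extreme_point_of P" if "i < n" for i
    using bij that by (auto simp: bij_betw_def)
  have AP: "A i \<in> P" if "i < n" for i using ext[OF that] by (simp add: extreme_point_of_def)
  have off: "A j \<notin> closed_segment (A i) (A (Suc i mod n))" if "i < n" "j < n" "j \<noteq> i" "j \<noteq> Suc i mod n" for i j
  proof
    assume "A j \<in> closed_segment (A i) (A (Suc i mod n))"
    then have "A j extreme_point_of closed_segment (A i) (A (Suc i mod n))"
      using extreme_point_of_face[of "closed_segment (A i) (A (Suc i mod n))" P "A j"] edge[OF that(1)] ext[OF that(2)]
      by (simp add: edge_of_def)
    then show False using that n by (simp add: extreme_point_of_segment inj)
  qed
  have third: "Suc (Suc i mod n) mod n < n" "Suc (Suc i mod n) mod n \<noteq> i" "Suc (Suc i mod n) mod n \<noteq> Suc i mod n" if "i < n" for i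
    using that n Suc_Suc_mod_neq[of n i] Suc_mod_neq[of n "Suc i mod n"] by auto
  have "\<exists>t. t \<noteq> 0 \<and> (\<forall>x\<in>P. t * cross2 (?e i) (x - A i) \<ge> 0) \<and>
    (\<forall>x\<in>P. cross2 (?e i) (x - A i) = 0 \<longrightarrow> x \<in> closed_segment (A i) (A (Suc i mod n)))" if "i < n" for i
    using edge_support[OF P edge[OF that], of "A (Suc (Suc i mod n) mod n)"] off[OF that] third[OF that] AP
      inj[OF that, of "Suc i mod n"] Suc_mod_neq[of n i] that n by auto
  then obtain t where t: "\<And>i. i < n \<Longrightarrow> t i \<noteq> 0" "\<And>i x. i < n \<Longrightarrow> x \<in> P \<Longrightarrow> t i * cross2 (?e i) (x - A i) \<ge> 0"
    "\<And>i x. i < n \<Longrightarrow> x \<in> P \<Longrightarrow> cross2 (?e i) (x - A i) = 0 \<Longrightarrow> x \<in> closed_segment (A i) (A (Suc i mod n))"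
    by metis
  have sgn_ge: "sgn (t i) * cross2 (?e i) (x - A i) \<ge> 0" if "i < n" "x \<in> P" for i x
    using t(1)[OF that(1)] t(2)[OF that] by (auto simp: sgn_real_def zero_le_mult_iff split: if_splits)
  have sgn_pos: "sgn (t i) * cross2 (?e i) (A j - A i) > 0" if "i < n" "j < n" "j \<noteq> i" "j \<noteq> Suc i mod n" for i j
  proof -
    have "cross2 (?e i) (A j - A i) \<noteq> 0" using t(3)[OF that(1) AP[OF that(2)]] off[OF that] by blast
    then show ?thesis using sgn_ge[OF that(1) AP[OF that(2)]] t(1)[OF that(1)]
      by (simp add: order_less_le sgn_zero_iff)
  qed
  have step: "sgn (t (Suc i)) = sgn (t i)" if "Suc i < n" for i
  proof -
    let ?k = "Suc (Suc i) mod n"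
    have m: "Suc i mod n = Suc i" using that by simp
    have "sgn (t i) * cross2 (?e i) (A ?k - A i) > 0"
      using sgn_pos[of i ?k] third[of i] that m by simp
    moreover have "sgn (t (Suc i)) * cross2 (?e (Suc i)) (A i - A (Suc i)) > 0"
      using sgn_pos[of "Suc i" i] third[of i] that m by auto
    moreover have "cross2 (?e (Suc i)) (A i - A (Suc i)) = cross2 (?e i) (A ?k - A i)"
      unfolding m by (simp add: cross2_def algebra_simps)
    ultimately show ?thesis
      using t(1)[of i] t(1)[of "Suc i"] that by (auto simp: sgn_real_def zero_less_mult_iff split: if_splits)
  qed
  have const: "sgn (t i) = sgn (t 0)" if "i < n" for i
    using that by (induction i) (auto simp: step)
  have "\<bar>sgn (t 0)\<bar> = 1" using t(1)[of 0] n by (simp add: abs_sgn_eq)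
  moreover have "sgn (t 0) * cross2 (?e i) (x - A i) \<ge> 0" if "i < n" "x \<in> P" for i x
    using sgn_ge[OF that] const[OF that(1)] by simp
  moreover have "sgn (t 0) * cross2 (?e i) (A (Suc (Suc i mod n) mod n) - A i) > 0" if "i < n" for i
    using sgn_pos[OF that third[OF that]] const[OF that] by simp
  ultimately show ?thesis by blast
qed

text \<open>
  The numbers \<open>f i = s * cross2 (a i) v\<close> sum up to zero because the points \<open>a i\<close> do. Hence the cyclic
  sequence changes sign from nonnegative to negative at some \<open>i\<close>, which means that \<open>v\<close> lies in the cone
  spanned by \<open>a i\<close> and its successor; the edge line then bounds \<open>v\<close> inside the triangle. This replaces
  a discussion of the winding number.
\<close>

lemma fan_covers:
  fixes a :: "nat \<Rightarrow> real^2" and s :: real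
  assumes n: "n > 0" and zero: "(\<Sum>i<n. a i) = 0"
    and pos: "\<And>i. i < n \<Longrightarrow> s * cross2 (a i) (a (Suc i mod n)) > 0"
    and inside: "\<And>i. i < n \<Longrightarrow> s * cross2 (a (Suc i mod n) - a i) (v - a i) \<ge> 0"
  shows "\<exists>i<n. v \<in> convex hull {0, a i, a (Suc i mod n)}"
proof (cases "v = 0")
  case True then show ?thesis using n by (auto intro!: exI[of _ 0] hull_inc)
next
  case False
  define f where "f i = s * cross2 (a i) v" for i
  have rep: "(s * cross2 (a i) (a (Suc i mod n))) *\<^sub>R v = (- f (Suc i mod n)) *\<^sub>R a i + f i *\<^sub>R a (Suc i mod n)" for i
    by (simp add: f_def cross2_def vec_eq_iff forall_2 algebra_simps)
  have sum0: "(\<Sum>i<n. f i) = 0"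
  proof -
    have "(\<Sum>i<n. f i) = - s * cross2 v (\<Sum>i<n. a i)"
      by (simp add: f_def cross2_sum cross2_commute[of _ v] sum_distrib_left sum_negf)
    then show ?thesis using zero by (simp add: cross2_simps)
  qed
  have "\<exists>i<n. f i \<ge> 0 \<and> f (Suc i mod n) < 0"
  proof (rule ccontr)
    assume "\<not> ?thesis"
    then have next_ge: "f (Suc i mod n) \<ge> 0" if "i < n" "f i \<ge> 0" for i using that by force
    obtain k where k: "k < n" "f k \<ge> 0"
    proof (rule ccontr)
      assume "\<not> thesis"
      then have "\<And>k. k < n \<Longrightarrow> f k < 0" using that by force
      then have "(\<Sum>i<n. f i) < (\<Sum>i<n. 0)" using n by (intro sum_strict_mono) auto
      then show False using sum0 by simp
    qed
    have shifted: "f ((k + j) mod n) \<ge> 0" for j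
    proof (induction j)
      case (Suc j)
      then show ?case using next_ge[of "(k + j) mod n"] n by (simp add: mod_Suc_eq)
    qed (use k in simp)
    have ge: "f i \<ge> 0" if "i < n" for i
      using shifted[of "n - k + i"] that k by simp
    then have "f i = 0" if "i < n" for i
      using sum0 sum_nonneg_eq_0_iff[of "{..<n}" f] that by auto
    then have "(s * cross2 (a 0) (a (Suc 0 mod n))) *\<^sub>R v = 0"
      using rep[of 0] n by simp
    then show False using pos[OF n] False by (metis less_irrefl scaleR_eq_0_iff)
  qed
  then obtain i where i: "i < n" "f i \<ge> 0" "f (Suc i mod n) < 0" by blast
  let ?b = "a (Suc i mod n)"
  define D where "D = s * cross2 (a i) ?b"
  have D: "D > 0" using pos i by (simp add: D_def)
  define \<alpha> \<beta> where "\<alpha> = - f (Suc i mod n) / D" and "\<beta> = f i / D"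
  have v: "v = \<alpha> *\<^sub>R a i + \<beta> *\<^sub>R ?b"
  proof -
    have "v = (1 / D) *\<^sub>R (D *\<^sub>R v)" using D by simp
    also have "D *\<^sub>R v = (- f (Suc i mod n)) *\<^sub>R a i + f i *\<^sub>R ?b" unfolding D_def by (rule rep)
    finally show ?thesis by (simp add: \<alpha>_def \<beta>_def scaleR_add_right scaleR_diff_right)
  qed
  have "s * cross2 (?b - a i) (v - a i) = D * (1 - \<alpha> - \<beta>)"
    unfolding v D_def by (simp add: cross2_simps cross2_commute[of ?b "a i"] algebra_simps)
  then have "\<alpha> + \<beta> \<le> 1" using inside[OF i(1)] D by (simp add: zero_le_mult_iff)
  moreover have "\<alpha> \<ge> 0" "\<beta> \<ge> 0" using i D by (auto simp: \<alpha>_def \<beta>_def divide_nonneg_pos divide_nonpos_pos)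
  ultimately have "v \<in> convex hull {0, a i, ?b}"
    unfolding convex_hull_3 mem_Collect_eq
    by (intro exI[of _ "1 - \<alpha> - \<beta>"] exI[of _ \<alpha>] exI[of _ \<beta>]) (simp add: v)
  then show ?thesis using i(1) by blast
qed

definition centered :: "nat \<Rightarrow> (nat \<Rightarrow> real^2) \<Rightarrow> nat \<Rightarrow> real^2" where
  "centered n A i = A i - vertex_barycenter n A"

lemma sum_centered: "n > 0 \<Longrightarrow> (\<Sum>i<n. centered n A i) = 0"
  by (simp add: centered_def vertex_barycenter_def sum_subtractf sum_constant_scaleR del: sum_constant)

lemma shoelace_to_complex: "shoelace n (\<lambda>i. to_complex (a i)) = (\<Sum>i<n. cross2 (a i) (a (Suc i mod n))) / 2"
  by (simp add: shoelace_def flip: cross2_to_complex)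

text \<open>
  The triangles spanned by the barycenter and the edges cover the polygon and are equally oriented, so
  their areas add up to the absolute value of the shoelace sum.
\<close>

lemma area_le_shoelace:
  assumes "convex_ngon n A P"
  shows "area P \<le> \<bar>shoelace n (\<lambda>i. to_complex (centered n A i))\<bar>"
proof -
  obtain s where s: "\<bar>s\<bar> = 1" "\<And>i x. i < n \<Longrightarrow> x \<in> P \<Longrightarrow> s * cross2 (A (Suc i mod n) - A i) (x - A i) \<ge> 0"
    "\<And>i. i < n \<Longrightarrow> s * cross2 (A (Suc i mod n) - A i) (A (Suc (Suc i mod n) mod n) - A i) > 0"
    using convex_ngon_orientation[OF assms] by blast
  have n: "n > 0" and P: "polytope P" and AP: "\<And>i. i < n \<Longrightarrow> A i \<in> P"
    using assms by (auto simp: convex_ngon_def bij_betw_def extreme_point_of_def)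
  let ?a = "centered n A"
  let ?G = "vertex_barycenter n A"
  have pos: "s * cross2 (?a i) (?a (Suc i mod n)) > 0" if i: "i < n" for i
  proof -
    let ?e = "A (Suc i mod n) - A i"
    have G: "real n *\<^sub>R (?G - A i) = (\<Sum>j<n. A j - A i)"
      using n by (simp add: vertex_barycenter_def sum_subtractf sum_constant_scaleR scaleR_diff_right del: sum_constant)
    have "real n * (s * cross2 ?e (?G - A i)) = s * cross2 ?e (real n *\<^sub>R (?G - A i))"
      by (simp add: cross2_simps(6))
    also have "\<dots> = (\<Sum>j<n. s * cross2 ?e (A j - A i))"
      unfolding G cross2_sum by (simp add: sum_distrib_left)
    also have "\<dots> > 0"
      using s(2)[OF i] s(3)[OF i] AP n
      by (intro sum_pos2[of _ "Suc (Suc i mod n) mod n"]) auto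
    finally have "s * cross2 ?e (?G - A i) > 0" using n by (simp add: zero_less_mult_iff)
    also have "cross2 ?e (?G - A i) = cross2 (?a i) (?a (Suc i mod n))"
      by (simp add: centered_def cross2_def algebra_simps)
    finally show ?thesis .
  qed
  let ?T = "\<lambda>i. convex hull {?G, A i, A (Suc i mod n)}"
  have cover: "P \<subseteq> (\<Union>i<n. ?T i)"
  proof
    fix x assume x: "x \<in> P"
    have "\<exists>i<n. x - ?G \<in> convex hull {0, ?a i, ?a (Suc i mod n)}"
    proof (rule fan_covers[OF n sum_centered[OF n] pos])
      fix i assume "i < n"
      then show "s * cross2 (?a (Suc i mod n) - ?a i) (x - ?G - ?a i) \<ge> 0"
        using s(2)[of i x] x by (simp add: centered_def)
    qed
    then obtain i where i: "i < n" "x - ?G \<in> convex hull {0, ?a i, ?a (Suc i mod n)}" by blast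
    have "?G + (x - ?G) \<in> (+) ?G ` (convex hull {0, ?a i, ?a (Suc i mod n)})"
      using i(2) by blast
    also have "\<dots> = ?T i"
      by (simp add: centered_def flip: convex_hull_translation)
    finally show "x \<in> (\<Union>i<n. ?T i)" using i(1) by auto
  qed
  have T: "?T i \<in> lmeasurable" for i
    by (intro lmeasurable_compact finite_imp_compact_convex_hull) simp
  have areaT: "area (?T i) = s * cross2 (?a i) (?a (Suc i mod n)) / 2" if "i < n" for i
    using pos[OF that] s(1) unfolding area_triangle centered_def[symmetric]
    by (metis abs_mult abs_of_pos mult_1)
  have "area P \<le> area (\<Union>i<n. ?T i)"
    unfolding area_def using cover T P
    by (intro measure_mono_fmeasurable fmeasurable.finite_UN)
      (auto simp: polytope_imp_compact lmeasurable_compact fmeasurableD)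
  also have "\<dots> \<le> (\<Sum>i<n. area (?T i))"
    unfolding area_def using T by (intro measure_UNION_le) (auto simp: fmeasurableD)
  also have "\<dots> = s * ((\<Sum>i<n. cross2 (?a i) (?a (Suc i mod n))) / 2)"
    unfolding sum_distrib_left sum_divide_distrib by (intro sum.cong) (auto simp: areaT)
  also have "\<dots> = s * shoelace n (\<lambda>i. to_complex (?a i))" by (simp add: shoelace_to_complex)
  also have "\<dots> \<le> \<bar>shoelace n (\<lambda>i. to_complex (?a i))\<bar>"
    using s(1) by (metis abs_ge_self abs_mult mult_1)
  finally show ?thesis .
qed

text \<open>
  A clockwise polygon is reflected by complex conjugation, which preserves sides, radii and angles.
\<close>

theorem polygonal_stability:
  assumes "n \<ge> 3"
  shows "\<exists>c>0. \<forall>A P. convex_ngon n A P \<longrightarrow>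
    radii_variance n A + area P * angle_variance n A \<le> c * deficit n A P"
proof -
  obtain c where c: "c > 0" "\<And>z S. (\<Sum>k<n. z k) = 0 \<Longrightarrow> 0 \<le> S \<Longrightarrow> S \<le> shoelace n z \<Longrightarrow>
    family_variance n (\<lambda>k. cmod (z k)) + S * family_variance n (\<lambda>k. cangle (z k) (z (Suc k mod n)))
      \<le> c * signed_deficit n z"
    using variances_le_signed_deficit[OF assms] by blast
  have "radii_variance n A + area P * angle_variance n A \<le> c * deficit n A P"
    if P: "convex_ngon n A P" for A P
  proof -
    define y where "y i = to_complex (centered n A i)" for i
    define z where "z = (if shoelace n y \<ge> 0 then y else cnj \<circ> y)"
    have y0: "(\<Sum>k<n. y k) = 0"
      using assms by (simp add: y_def sum_centered to_complex_simps flip: to_complex_sum)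
    have refl: "shoelace n (cnj \<circ> y) = - shoelace n y"
    proof -
      have "Im (cnj (cnj u) * cnj v) = - Im (cnj u * v)" for u v by simp
      then show ?thesis by (simp only: shoelace_def o_def sum_negf minus_divide_left)
    qed
    have z0: "(\<Sum>k<n. z k) = 0"
      using y0 by (simp add: z_def flip: cnj_sum)
    have area: "area P \<le> shoelace n z"
      using area_le_shoelace[OF P] refl by (auto simp: z_def y_def[symmetric])
    have norm: "cmod (z k) = radius n A k" for k
      by (simp add: z_def y_def norm_to_complex centered_def radius_def dist_norm norm_minus_commute)
    have sides: "side n z k = dist (A k) (A (Suc k mod n))" for k
    proof -
      have "side n z k = side n y k"
        by (simp add: z_def side_def dist_norm flip: complex_cnj_diff)
      also have "\<dots> = dist (centered n A k) (centered n A (Suc k mod n))"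
        by (simp only: side_def y_def dist_to_complex)
      finally show ?thesis by (simp add: centered_def dist_norm)
    qed
    have angle: "cangle (z k) (z (Suc k mod n)) = central_angle n A k" for k
    proof -
      have "cangle (z k) (z (Suc k mod n)) = cangle (y k) (y (Suc k mod n))"
        by (simp add: z_def cangle_def sgn_eq inner_complex_def)
      then show ?thesis by (simp add: y_def central_angle_def vec_angle_to_complex centered_def)
    qed
    have "radii_variance n A + area P * angle_variance n A \<le> c * signed_deficit n z"
      using c(2)[OF z0 _ area] by (simp add: norm angle radii_variance_def angle_variance_def area_def cong: if_cong)
    also have "signed_deficit n z \<le> deficit n A P"
    proof -
      have "4 * real n * tan (pi / real n) * area P \<le> 4 * real n * tan (pi / real n) * shoelace n z"
        using area tan_pi_div_pos[OF assms] by (intro mult_left_mono) auto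
      then show ?thesis
        by (simp add: signed_deficit_def deficit_def circumference_def perimeter_def sides)
    qed
    finally show ?thesis using c(1) by simp
  qed
  then show ?thesis using c(1) by blast
qed

section \<open>Affinely regular polygons and sharpness of the exponent\<close>

text \<open>
  The rotation by a right angle; it expresses the cross product as an inner product, as needed for
  supporting hyperplanes.
\<close>

definition turn :: "real^2 \<Rightarrow> real^2" where
  "turn e = vector [- e $ 2, e $ 1]"

lemma turn_inner: "turn e \<bullet> y = cross2 e y"
  by (simp add: turn_def cross2_def inner_vec_def sum_2)

text \<open>
  If all other points lie strictly to the left of the line through two consecutive points, this line cuts the convex
  hull in exactly the segment between them.
\<close>

lemma convex_ngon_convex_hull:
  assumes n: "n \<ge> 3"
    and left: "\<And>i j. i < n \<Longrightarrow> j < n \<Longrightarrow> j \<noteq> i \<Longrightarrow> j \<noteq> Suc i mod n \<Longrightarrow>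
      cross2 (A (Suc i mod n) - A i) (A j - A i) > 0"
  shows "convex_ngon n A (convex hull (A ` {..<n}))"
proof -
  let ?P = "convex hull (A ` {..<n})"
  have third: "Suc (Suc i mod n) mod n < n" "Suc (Suc i mod n) mod n \<noteq> i" "Suc (Suc i mod n) mod n \<noteq> Suc i mod n" if "i < n" for i
    using that n Suc_Suc_mod_neq[of n i] Suc_mod_neq[of n "Suc i mod n"] by auto
  have neq: "A i \<noteq> A (Suc i mod n)" if "i < n" for i
    using left[OF that third[OF that]] by (auto simp: cross2_simps)
  have inj: "inj_on A {..<n}"
  proof (rule inj_onI)
    fix i j assume ij: "i \<in> {..<n}" "j \<in> {..<n}" "A i = A j"
    show "i = j"
    proof (rule ccontr)
      assume "i \<noteq> j"
      then show False using left[of i j] neq[of i] ij by (cases "j = Suc i mod n") (auto simp: cross2_simps)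
    qed
  qed
  have face: "closed_segment (A i) (A (Suc i mod n)) face_of ?P" if i: "i < n" for i
  proof -
    let ?d = "turn (A (Suc i mod n) - A i)"
    let ?H = "{x. ?d \<bullet> x = ?d \<bullet> A i}"
    have ge: "?d \<bullet> A j \<ge> ?d \<bullet> A i" if "j < n" for j
      using left[OF i that] by (cases "j = i \<or> j = Suc i mod n") (auto simp: turn_inner cross2_simps cross2_def algebra_simps)
    have "?P \<subseteq> {x. ?d \<bullet> x \<ge> ?d \<bullet> A i}"
      using ge by (intro hull_minimal) (auto simp: convex_halfspace_ge)
    then have F: "(?P \<inter> ?H) face_of ?P"
      by (intro face_of_Int_supporting_hyperplane_ge) auto
    then obtain S where S: "S \<subseteq> A ` {..<n}" "?P \<inter> ?H = convex hull S"
      using face_of_convex_hull_subset[of "A ` {..<n}"] by (metis finite_imageI finite_imp_compact finite_lessThan)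
    have "S \<subseteq> {A i, A (Suc i mod n)}"
    proof
      fix x assume "x \<in> S"
      then have "x \<in> ?H" using S(2) hull_subset[of S convex] by blast
      moreover obtain j where j: "x = A j" "j < n" using \<open>x \<in> S\<close> S(1) by auto
      ultimately have "cross2 (A (Suc i mod n) - A i) (A j - A i) = 0"
        by (simp add: turn_inner cross2_simps(4))
      then show "x \<in> {A i, A (Suc i mod n)}" using left[OF i j(2)] j(1) by fastforce
    qed
    then have "?P \<inter> ?H \<subseteq> closed_segment (A i) (A (Suc i mod n))"
      unfolding S(2) segment_convex_hull by (rule hull_mono)
    moreover have "closed_segment (A i) (A (Suc i mod n)) \<subseteq> ?P \<inter> ?H"
    proof (rule closed_segment_subset)
      have "i < n" "Suc i mod n < n" using i by auto
      then show "A i \<in> ?P \<inter> ?H" "A (Suc i mod n) \<in> ?P \<inter> ?H"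
        by (auto intro!: hull_inc simp: turn_inner cross2_def algebra_simps)
      show "convex (?P \<inter> ?H)" by (intro convex_Int convex_convex_hull convex_hyperplane)
    qed
    ultimately show ?thesis using F by (metis subset_antisym)
  qed
  have "{v. v extreme_point_of ?P} = A ` {..<n}"
  proof (intro subset_antisym subsetI)
    fix v assume "v \<in> A ` {..<n}"
    then obtain i where i: "i < n" "v = A i" by auto
    then have "v extreme_point_of closed_segment (A i) (A (Suc i mod n))"
      by (simp add: extreme_point_of_segment)
    then show "v \<in> {v. v extreme_point_of ?P}"
      using extreme_point_of_face[OF face[OF i(1)]] by simp
  qed (use extreme_point_of_convex_hull in auto)
  then have "bij_betw A {..<n} {v. v extreme_point_of ?P}"
    using inj by (simp add: bij_betw_def)
  moreover have "closed_segment (A i) (A (Suc i mod n)) edge_of ?P" if "i < n" for i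
    unfolding edge_of_def using face[OF that] neq[OF that]
    by (simp add: segment_convex_hull aff_dim_convex_hull)
  moreover have "polytope ?P"
    unfolding polytope_def by blast
  ultimately show ?thesis using n by (simp add: convex_ngon_def)
qed

text \<open>
  The vertices of the regular polygon, stretched by \<open>p\<close> and \<open>q\<close> along the coordinate axes.
\<close>

definition ellipse_point :: "nat \<Rightarrow> real \<Rightarrow> real \<Rightarrow> nat \<Rightarrow> real^2" where
  "ellipse_point n p q k = vector [p * Re (primroot n ^ k), q * Im (primroot n ^ k)]"

lemma cross2_ellipse_edge:
  assumes "n > 0"
  shows "cross2 (ellipse_point n p q (Suc i mod n) - ellipse_point n p q i) (ellipse_point n p q j - ellipse_point n p q i)
    = 4 * p * q * sin (pi / real n) * sin (pi * (real j - real i - 1) / real n) * sin (pi * (real j - real i) / real n)"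
proof -
  define \<alpha> where "\<alpha> = 2 * pi * real i / real n"
  define x where "x = pi / real n"
  define y where "y = pi * (real j - real i - 1) / real n"
  have 1: "2 * pi * real (Suc i) / real n = \<alpha> + 2 * x" "2 * pi * real j / real n = \<alpha> + 2 * x + 2 * y"
    "pi * (real j - real i) / real n = x + y"
    by (simp_all add: \<alpha>_def x_def y_def add_divide_distrib diff_divide_distrib algebra_simps)
  have prod: "(cos (\<alpha> + 2 * x) - cos \<alpha>) * (sin (\<alpha> + 2 * x + 2 * y) - sin \<alpha>)
     - (sin (\<alpha> + 2 * x) - sin \<alpha>) * (cos (\<alpha> + 2 * x + 2 * y) - cos \<alpha>)
     = 4 * sin x * sin y * sin (x + y)"
  proof -
    have "(cos (\<alpha> + 2 * x) - cos \<alpha>) * (sin (\<alpha> + 2 * x + 2 * y) - sin \<alpha>)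
     - (sin (\<alpha> + 2 * x) - sin \<alpha>) * (cos (\<alpha> + 2 * x + 2 * y) - cos \<alpha>)
     = sin ((\<alpha> + 2 * x + 2 * y) - (\<alpha> + 2 * x)) - sin ((\<alpha> + 2 * x + 2 * y) - \<alpha>) + sin ((\<alpha> + 2 * x) - \<alpha>)"
      unfolding sin_diff by (simp add: algebra_simps)
    also have "\<dots> = sin (2 * y) + sin (2 * x) - sin (2 * (x + y))" by (simp add: algebra_simps)
    also have "\<dots> = 2 * sin (x + y) * (cos (x - y) - cos (x + y))"
    proof -
      have "sin (2 * y) + sin (2 * x) = 2 * sin (x + y) * cos (x - y)"
        by (simp add: sin_plus_sin add_divide_distrib diff_divide_distrib cos_diff add.commute mult_ac)
      then show ?thesis unfolding sin_double[of "x + y"] by (simp add: right_diff_distrib)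
    qed
    also have "cos (x - y) - cos (x + y) = 2 * sin x * sin y" by (simp add: cos_add cos_diff)
    finally show ?thesis by simp
  qed
  have "cross2 (ellipse_point n p q (Suc i mod n) - ellipse_point n p q i) (ellipse_point n p q j - ellipse_point n p q i)
    = p * q * ((cos (\<alpha> + 2 * x) - cos \<alpha>) * (sin (\<alpha> + 2 * x + 2 * y) - sin \<alpha>)
     - (sin (\<alpha> + 2 * x) - sin \<alpha>) * (cos (\<alpha> + 2 * x + 2 * y) - cos \<alpha>))"
    unfolding ellipse_point_def primroot_power_Suc_mod[OF assms]
    unfolding primroot_power 1 \<alpha>_def[symmetric] cross2_def
    by (simp add: algebra_simps)
  then show ?thesis unfolding prod 1(3) x_def[symmetric] y_def[symmetric] by simp
qed

lemma convex_ngon_ellipse: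
  assumes "n \<ge> 3" "p > 0" "q > 0"
  shows "convex_ngon n (ellipse_point n p q) (convex hull (ellipse_point n p q ` {..<n}))"
proof (rule convex_ngon_convex_hull[OF assms(1)])
  fix i j assume ij: "i < n" "j < n" "j \<noteq> i" "j \<noteq> Suc i mod n"
  have n: "real n > 0" using assms by simp
  have x: "sin (pi / real n) > 0" using assms by (intro sin_gt_zero) (auto simp: field_simps)
  have "sin (pi * (real j - real i - 1) / real n) * sin (pi * (real j - real i) / real n) > 0"
  proof (cases "i < j")
    case True
    then have "Suc i < j" using ij by (cases "j = Suc i") auto
    have r: "real j - real i - 1 > 0" "real j - real i - 1 < real n" "real j - real i < real n"
      using \<open>Suc i < j\<close> ij by linarith+
    have "pi * (real j - real i - 1) < pi * real n" "pi * (real j - real i) < pi * real n"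
      using r by (intro mult_strict_left_mono; simp)+
    then show ?thesis using r n by (intro mult_pos_pos sin_gt_zero) (auto simp: divide_less_eq)
  next
    case False
    then have "j < i" using ij by simp
    have "\<not> (j = 0 \<and> Suc i = n)" using ij by auto
    then have r: "real i - real j > 0" "real i - real j + 1 < real n" "real i - real j < real n"
      using \<open>j < i\<close> ij by linarith+
    have "pi * (real i - real j + 1) < pi * real n" "pi * (real i - real j) < pi * real n"
      using r by (intro mult_strict_left_mono; simp)+
    then have "sin (pi * (real i - real j + 1) / real n) * sin (pi * (real i - real j) / real n) > 0"
      using r n by (intro mult_pos_pos sin_gt_zero) (auto simp: divide_less_eq)
    moreover have neg: "pi * (real j - real i - 1) = - (pi * (real i - real j + 1))"
      "pi * (real j - real i) = - (pi * (real i - real j))"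
      by (simp_all add: algebra_simps)
    have "pi * (real j - real i - 1) / real n = - (pi * (real i - real j + 1) / real n)"
      "pi * (real j - real i) / real n = - (pi * (real i - real j) / real n)"
      unfolding neg by (simp_all only: minus_divide_left)
    ultimately show ?thesis by (simp only: sin_minus mult_minus_left mult_minus_right minus_minus)
  qed
  then show "0 < cross2 (ellipse_point n p q (Suc i mod n) - ellipse_point n p q i) (ellipse_point n p q j - ellipse_point n p q i)"
    using assms x n by (subst cross2_ellipse_edge) (auto simp: mult.assoc zero_less_mult_iff)
qed

text \<open>
  An angle \<open>\<phi>\<close> that is counterclockwise after one ray and before the next one, both by less than \<open>pi\<close>, lies in
  the \<open>k\<close>-th of the \<open>n\<close> equal sectors. So the index \<open>k\<close> is determined by \<open>\<phi>\<close>.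
\<close>

lemma sector_index:
  fixes \<phi> :: real and n k :: nat
  assumes "n \<ge> 3" "0 \<le> \<phi>" "\<phi> < 2 * pi" "k < n"
    and "sin (\<phi> - 2 * pi * real k / real n) > 0" "sin (2 * pi * real (Suc k) / real n - \<phi>) > 0"
  shows "int k = \<lfloor>\<phi> * real n / (2 * pi)\<rfloor>"
proof -
  define h where "h = 2 * pi / real n"
  have h: "0 < h" "h < pi" using assms by (auto simp: h_def field_simps)
  have th: "2 * pi * real k / real n = h * real k" "2 * pi * real (Suc k) / real n = h * real k + h"
    using assms(1) by (simp_all add: h_def field_simps)
  have nh: "h * real n = 2 * pi" using assms by (simp add: h_def)
  have kn: "0 \<le> h * real k" "h * real k + h \<le> 2 * pi"
    using mult_left_mono[of "real k + 1" "real n" h] assms h nh by (auto simp: algebra_simps)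
  define t where "t = \<phi> - h * real k"
  have t: "sin t > 0" "sin (h - t) > 0" using assms(5,6) unfolding th t_def by (simp_all add: algebra_simps)
  have tb: "- 2 * pi < t" "t < 2 * pi" "- 2 * pi + h \<le> t" using assms(2,3) kn h unfolding t_def by linarith+
  have "0 < t"
  proof (rule ccontr)
    assume neg: "\<not> 0 < t"
    have "\<not> (- pi \<le> t \<and> t \<le> 0)" using t(1) sin_ge_zero[of "- t"] by auto
    then have "t < - pi" using neg by auto
    have "sin (h - t) = - sin (h - t - pi)" by (simp add: sin_diff)
    moreover have "sin (h - t - pi) \<ge> 0"
      using \<open>t < - pi\<close> tb h by (intro sin_ge_zero) auto
    ultimately show False using t(2) by simp
  qed
  moreover have "t < h"
  proof (rule ccontr)
    assume "\<not> t < h"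
    have "t < pi"
    proof (rule ccontr)
      assume "\<not> t < pi"
      then have "sin (t - pi) \<ge> 0" using tb by (intro sin_ge_zero) auto
      then show False using t(1) by (simp add: sin_diff)
    qed
    then have "sin (t - h) \<ge> 0" using \<open>\<not> t < h\<close> h by (intro sin_ge_zero) auto
    moreover have "sin (h - t) = - sin (t - h)" using sin_minus[of "t - h"] by simp
    ultimately show False using t(2) by simp
  qed
  ultimately have "h * real k < \<phi>" "\<phi> < h * (real k + 1)" by (auto simp: t_def algebra_simps)
  moreover have "\<phi> * real n / (2 * pi) = \<phi> / h" by (simp add: h_def)
  ultimately have "real k < \<phi> * real n / (2 * pi)" "\<phi> * real n / (2 * pi) < real k + 1"
    using h by (simp_all add: pos_less_divide_eq pos_divide_less_eq mult.commute)
  then show ?thesis by (intro floor_unique[symmetric]) auto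
qed

lemma cross2_ellipse_polar:
  "cross2 (ellipse_point n p q k) (vector [p * (r * cos \<phi>), q * (r * sin \<phi>)])
    = p * q * r * sin (\<phi> - 2 * pi * real k / real n)"
  by (simp add: ellipse_point_def primroot_power cross2_def sin_diff algebra_simps)

lemma sum_primroot_power:
  assumes "0 < m" "m < n" shows "(\<Sum>k<n. primroot n ^ (m * k)) = 0"
  using roots_of_unity_orthogonal[of m n 0] assms by simp

lemma sum_ellipse_points:
  assumes "n \<ge> 3" shows "(\<Sum>k<n. ellipse_point n p q k) = 0"
proof -
  have "(\<Sum>k<n. primroot n ^ k) = 0" using sum_primroot_power[of 1 n] assms by simp
  then have "(\<Sum>k<n. Re (primroot n ^ k)) = 0" "(\<Sum>k<n. Im (primroot n ^ k)) = 0"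
    by (simp_all flip: Re_sum Im_sum)
  then show ?thesis
    by (simp add: vec_eq_iff forall_2 ellipse_point_def sum_component flip: sum_distrib_left)
qed

text \<open>
  The triangles spanned by the center and the edges are contained in the polygon and overlap only on the
  rays through the vertices: in the polar coordinates of the ellipse the \<open>k\<close>-th triangle lies in the \<open>k\<close>-th sector.
\<close>

lemma area_ellipse_ge:
  assumes n: "n \<ge> 3" and pq: "p > 0" "q > 0"
  shows "area (convex hull (ellipse_point n p q ` {..<n})) \<ge> p * q * real n * sin (2 * pi / real n) / 2"
proof -
  let ?A = "ellipse_point n p q"
  let ?P = "convex hull (?A ` {..<n})"
  define T where "T i = convex hull {0, ?A i, ?A (Suc i mod n)}" for i
  have n0: "n > 0" using n by simp
  have crossA: "cross2 (?A i) (?A (Suc i mod n)) = p * q * sin (2 * pi / real n)" for i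
  proof -
    have "cross2 (?A i) (?A (Suc i mod n)) = p * q * sin (2 * pi * real (Suc i) / real n - 2 * pi * real i / real n)"
      unfolding ellipse_point_def primroot_power_Suc_mod[OF n0] unfolding primroot_power
      by (simp add: cross2_def sin_diff algebra_simps)
    also have "2 * pi * real (Suc i) / real n - 2 * pi * real i / real n = 2 * pi / real n"
      using n0 by (simp add: field_simps)
    finally show ?thesis .
  qed
  have sp: "sin (2 * pi / real n) > 0" using n by (intro sin_gt_zero) (auto simp: field_simps)
  have T: "T i \<in> lmeasurable" for i
    unfolding T_def by (intro lmeasurable_compact finite_imp_compact_convex_hull) simp
  have areaT: "area (T i) = p * q * sin (2 * pi / real n) / 2" for i
    unfolding T_def area_triangle using crossA[of i] sp pq by simp
  have cone: "cross2 (?A i) x \<ge> 0 \<and> cross2 x (?A (Suc i mod n)) \<ge> 0" if x: "x \<in> T i" for x i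
  proof -
    obtain \<alpha> \<beta> where "\<alpha> \<ge> 0" "\<beta> \<ge> 0" "x = \<alpha> *\<^sub>R ?A i + \<beta> *\<^sub>R ?A (Suc i mod n)"
      using x unfolding T_def convex_hull_3 by auto
    moreover have "cross2 (?A i) (?A (Suc i mod n)) \<ge> 0" using crossA sp pq by simp
    ultimately show ?thesis by (simp add: cross2_simps)
  qed
  \<comment> \<open>The union of the lines through the center and the vertices, on which the boundaries of the sectors lie.\<close>
  define N where "N = (\<Union>k\<in>{..n}. {x. turn (?A k) \<bullet> x = 0})"
  have line: "negligible {x. turn (?A k) \<bullet> x = 0}" for k
  proof -
    have "?A k \<noteq> 0"
    proof
      assume "?A k = 0"
      then have "Re (primroot n ^ k) = 0" "Im (primroot n ^ k) = 0"
        using pq by (auto simp: ellipse_point_def vec_eq_iff forall_2)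
      then show False using cmod_primroot_power[of n k] by (simp add: cmod_def)
    qed
    then have "turn (?A k) \<noteq> 0" by (auto simp: turn_def vec_eq_iff forall_2)
    then show ?thesis by (intro negligible_hyperplane) auto
  qed
  have "negligible N"
    unfolding N_def by (intro negligible_Union) (auto simp: line)
  have disj: "T i \<inter> T j \<subseteq> N" if ij: "i < n" "j < n" "i \<noteq> j" for i j
  proof
    fix x assume x: "x \<in> T i \<inter> T j"
    show "x \<in> N"
    proof (rule ccontr)
      assume xN: "x \<notin> N"
      define y where "y = Complex (x $ 1 / p) (x $ 2 / q)"
      define \<phi> where "\<phi> = Arg2pi y"
      have xr: "x = vector [p * (cmod y * cos \<phi>), q * (cmod y * sin \<phi>)]"
      proof -
        have "y = of_real (cmod y) * cis \<phi>" unfolding \<phi>_def cis_conv_exp by (rule Arg2pi_eq)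
        then have "Re y = Re (of_real (cmod y) * cis \<phi>)" "Im y = Im (of_real (cmod y) * cis \<phi>)" by simp_all
        then have "Re y = cmod y * cos \<phi>" "Im y = cmod y * sin \<phi>" by simp_all
        then show ?thesis using pq by (simp add: y_def vec_eq_iff forall_2 field_simps)
      qed
      have idx: "int k = \<lfloor>\<phi> * real n / (2 * pi)\<rfloor>" if k: "k < n" "x \<in> T k" for k
      proof (rule sector_index[OF n _ _ k(1)])
        show "0 \<le> \<phi>" "\<phi> < 2 * pi" by (simp_all add: \<phi>_def Arg2pi_ge_0 Arg2pi_lt_2pi)
        have nz: "cross2 (?A m) x \<noteq> 0" if "m \<le> n" for m
          using xN that by (auto simp: N_def turn_inner)
        have r: "p * q * cmod y \<ge> 0" using pq by simp
        have "cross2 (?A k) x > 0" using cone[OF k(2)] nz[of k] k(1) by simp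
        then show "sin (\<phi> - 2 * pi * real k / real n) > 0"
          using r unfolding xr cross2_ellipse_polar by (auto simp: zero_less_mult_iff)
        have "?A (Suc k mod n) = ?A (Suc k)" by (simp add: ellipse_point_def primroot_power_Suc_mod[OF n0])
        then have "cross2 (?A (Suc k)) x < 0"
          using cone[OF k(2)] nz[of "Suc k"] k(1) cross2_commute[of x "?A (Suc k)"] by simp
        then have "sin (\<phi> - 2 * pi * real (Suc k) / real n) < 0"
          using r unfolding xr cross2_ellipse_polar by (meson mult_nonneg_nonneg not_le)
        then show "sin (2 * pi * real (Suc k) / real n - \<phi>) > 0"
          using sin_minus[of "\<phi> - 2 * pi * real (Suc k) / real n"] by simp
      qed
      have "int i = int j" using idx[of i] idx[of j] x ij by simp
      then show False using ij by simp
    qed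
  qed
  have "p * q * real n * sin (2 * pi / real n) / 2 = (\<Sum>i<n. area (T i))"
    by (simp add: areaT)
  also have "\<dots> = area (\<Union>i<n. T i)"
    unfolding area_def
  proof (intro measure_negligible_finite_Union_image[symmetric] T)
    show "pairwise (\<lambda>i j. negligible (T i \<inter> T j)) {..<n}"
      using disj \<open>negligible N\<close> by (auto simp: pairwise_def intro: negligible_subset)
  qed simp
  also have "\<dots> \<le> area ?P"
  proof -
    have "0 \<in> ?P"
    proof -
      have "(1 / real n) *\<^sub>R (\<Sum>k<n. ?A k) \<in> ?P"
        unfolding scaleR_sum_right using n0 by (intro convex_sum) (auto intro: hull_inc)
      then show ?thesis by (simp add: sum_ellipse_points[OF n])
    qed
    moreover have "?A k \<in> ?P" if "k < n" for k using that by (intro hull_inc) auto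
    ultimately have "T i \<subseteq> ?P" if "i < n" for i
      unfolding T_def using that n0 by (intro hull_minimal) auto
    then show ?thesis
      unfolding area_def using T
      by (intro measure_mono_fmeasurable lmeasurable_compact finite_imp_compact_convex_hull)
        (auto intro!: sets.finite_UN fmeasurableD)
  qed
  finally show ?thesis .
qed

text \<open>
  In complex notation the vertices are \<open>u w^k + v w^(-k)\<close>, so only the modes \<open>1\<close> and \<open>n - 1\<close> occur.
  They are orthogonal since \<open>n \<ge> 3\<close>, and their contributions add up without a mixed term in \<open>u v\<close>.
\<close>

lemma energy_ellipse:
  assumes n: "n \<ge> 3"
  shows "energy n (\<lambda>k. to_complex (ellipse_point n (u + v) (u - v) k))
    = 4 * real n * (sin (pi / real n))\<^sup>2 * (u\<^sup>2 + v\<^sup>2)"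
proof -
  let ?w = "primroot n"
  let ?z = "\<lambda>k. to_complex (ellipse_point n (u + v) (u - v) k)"
  define c where "c = ?w - 1"
  have cnorm: "(cmod c)\<^sup>2 = 4 * (sin (pi / real n))\<^sup>2"
  proof -
    have "(cmod c)\<^sup>2 = (cos (2 * pi / real n) - 1)\<^sup>2 + (sin (2 * pi / real n))\<^sup>2"
      by (simp add: c_def primroot_def cmod_power2)
    also have "\<dots> = 2 - 2 * cos (2 * (pi / real n))"
      using sin_cos_squared_add[of "2 * pi / real n"] by (simp add: power2_diff)
    also have "\<dots> = 4 * (sin (pi / real n))\<^sup>2" unfolding cos_double_sin by simp
    finally show ?thesis .
  qed
  have sd: "(side n ?z k)\<^sup>2 = (cmod c)\<^sup>2 * (u\<^sup>2 + v\<^sup>2) + 2 * u * v * Re (c\<^sup>2 * ?w ^ (2 * k))" for k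
  proof -
    define d where "d = c * ?w ^ k"
    have d: "d = ?w ^ (Suc k mod n) - ?w ^ k"
      using n by (simp add: primroot_power_Suc_mod d_def c_def algebra_simps)
    have "?z (Suc k mod n) - ?z k = Complex ((u + v) * Re d) ((u - v) * Im d)"
      unfolding d by (simp add: to_complex_def ellipse_point_def complex_eq_iff algebra_simps)
    moreover have "side n ?z k = cmod (?z (Suc k mod n) - ?z k)"
      unfolding side_def dist_norm by (rule norm_minus_commute)
    ultimately have "(side n ?z k)\<^sup>2 = ((u + v) * Re d)\<^sup>2 + ((u - v) * Im d)\<^sup>2"
      by (simp only: cmod_power2 complex.sel)
    also have "\<dots> = (u\<^sup>2 + v\<^sup>2) * ((Re d)\<^sup>2 + (Im d)\<^sup>2) + 2 * u * v * ((Re d)\<^sup>2 - (Im d)\<^sup>2)"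
      by (simp add: power2_eq_square algebra_simps)
    also have "(Re d)\<^sup>2 + (Im d)\<^sup>2 = (cmod c)\<^sup>2"
      unfolding cmod_power2[symmetric] by (simp add: d_def norm_mult cmod_primroot_power)
    also have "(Re d)\<^sup>2 - (Im d)\<^sup>2 = Re (d\<^sup>2)" by (simp add: power2_eq_square)
    also have "d\<^sup>2 = c\<^sup>2 * ?w ^ (2 * k)" by (simp add: d_def power_mult_distrib mult.commute flip: power_mult)
    finally show ?thesis by (simp add: mult.commute)
  qed
  have "(\<Sum>k<n. Re (c\<^sup>2 * ?w ^ (2 * k))) = Re (c\<^sup>2 * (\<Sum>k<n. ?w ^ (2 * k)))"
    by (simp add: sum_distrib_left)
  also have "\<dots> = 0" using sum_primroot_power[of 2 n] n by simp
  finally have "(\<Sum>k<n. Re (c\<^sup>2 * ?w ^ (2 * k))) = 0" .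
  then have "energy n ?z = real n * ((cmod c)\<^sup>2 * (u\<^sup>2 + v\<^sup>2))"
    unfolding energy_def sd sum.distrib sum_distrib_left[symmetric] by (simp add: distrib_left)
  then show ?thesis by (simp add: cnorm)
qed

text \<open>
  By the Cauchy-Schwarz inequality \<open>L^2 \<le> n * energy\<close>. The energy is proportional to \<open>u^2 + v^2\<close> and the
  area to \<open>u^2 - v^2\<close>, and for the regular polygon, where \<open>v = 0\<close>, the two terms of the deficit cancel.
\<close>

lemma deficit_ellipse_le:
  assumes n: "n \<ge> 3" and uv: "\<bar>v\<bar> < u"
  shows "deficit n (ellipse_point n (u + v) (u - v)) (convex hull (ellipse_point n (u + v) (u - v) ` {..<n}))
    \<le> 8 * (real n)\<^sup>2 * v\<^sup>2"
proof -
  let ?A = "ellipse_point n (u + v) (u - v)"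
  let ?z = "\<lambda>k. to_complex (?A k)"
  let ?P = "convex hull (?A ` {..<n})"
  define t where "t = tan (pi / real n)"
  define s where "s = sin (pi / real n)"
  have t: "t > 0" using tan_pi_div_pos[OF n] by (simp add: t_def)
  have per: "perimeter n ?A = circumference n ?z"
    by (simp add: perimeter_def circumference_def side_def dist_to_complex)
  have "(perimeter n ?A)\<^sup>2 \<le> real n * energy n ?z"
    using side_spread_nonneg[of n ?z] by (simp add: per side_spread_def)
  also have "\<dots> = 4 * (real n)\<^sup>2 * s\<^sup>2 * (u\<^sup>2 + v\<^sup>2)"
    by (simp add: energy_ellipse[OF n] s_def power2_eq_square mult_ac)
  finally have L: "(perimeter n ?A)\<^sup>2 \<le> 4 * (real n)\<^sup>2 * s\<^sup>2 * (u\<^sup>2 + v\<^sup>2)" .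
  have "(u + v) * (u - v) * real n * sin (2 * pi / real n) / 2 \<le> area ?P"
    using uv by (intro area_ellipse_ge n) auto
  then have "4 * real n * t * ((u + v) * (u - v) * real n * sin (2 * pi / real n) / 2) \<le> 4 * real n * t * area ?P"
    using t by (intro mult_left_mono) auto
  moreover have "4 * real n * t * ((u + v) * (u - v) * real n * sin (2 * pi / real n) / 2)
    = 4 * (real n)\<^sup>2 * s\<^sup>2 * (u\<^sup>2 - v\<^sup>2)"
  proof -
    have "t * sin (2 * pi / real n) = 2 * s\<^sup>2"
      using sin_double[of "pi / real n"] cos_pi_div_pos[OF n] by (simp add: t_def s_def tan_def power2_eq_square)
    moreover have "4 * real n * t * ((u + v) * (u - v) * real n * sin (2 * pi / real n) / 2)
      = 2 * (real n)\<^sup>2 * ((u + v) * (u - v)) * (t * sin (2 * pi / real n))"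
      by (simp add: power2_eq_square mult_ac)
    ultimately show ?thesis by (simp add: power2_eq_square algebra_simps)
  qed
  ultimately have "deficit n ?A ?P \<le> 4 * (real n)\<^sup>2 * s\<^sup>2 * (u\<^sup>2 + v\<^sup>2) - 4 * (real n)\<^sup>2 * s\<^sup>2 * (u\<^sup>2 - v\<^sup>2)"
    using L unfolding deficit_def t_def[symmetric] by linarith
  also have "\<dots> = 8 * (real n)\<^sup>2 * v\<^sup>2 * s\<^sup>2" by (simp add: algebra_simps)
  also have "\<dots> \<le> 8 * (real n)\<^sup>2 * v\<^sup>2 * 1"
    unfolding s_def by (intro mult_left_mono) (auto simp: abs_square_le_1)
  finally show ?thesis by simp
qed


lemma family_variance_ge_pair:
  assumes "i < n" "j < n" "i \<noteq> j"
  shows "(f i - f j)\<^sup>2 / (2 * real n) \<le> family_variance n f"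
proof -
  define m where "m = (\<Sum>i<n. f i) / real n"
  have "(f i - f j)\<^sup>2 \<le> 2 * ((f i - m)\<^sup>2 + (f j - m)\<^sup>2)"
    using zero_le_power2[of "(f i - m) + (f j - m)"] by (simp add: power2_eq_square algebra_simps)
  also have "(f i - m)\<^sup>2 + (f j - m)\<^sup>2 = (\<Sum>k\<in>{i, j}. (f k - m)\<^sup>2)"
    using assms by simp
  also have "\<dots> \<le> (\<Sum>k<n. (f k - m)\<^sup>2)"
    using assms by (intro sum_mono2) auto
  finally have "(f i - f j)\<^sup>2 / (2 * real n) \<le> (2 * (\<Sum>k<n. (f k - m)\<^sup>2)) / (2 * real n)"
    by (intro divide_right_mono) auto
  also have "\<dots> = family_variance n f"
    using assms by (subst family_variance_eq[of n f m]) (auto simp: m_def)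
  finally show ?thesis .
qed

lemma family_variance_nonneg: "n > 0 \<Longrightarrow> family_variance n f \<ge> 0"
  using family_variance_eq[of n f "(\<Sum>i<n. f i) / real n"] by (simp add: sum_nonneg)

lemma radius_ellipse:
  "n \<ge> 3 \<Longrightarrow> radius n (ellipse_point n p q) k = norm (ellipse_point n p q k)"
  by (simp add: radius_def vertex_barycenter_def sum_ellipse_points)

lemma radius_ellipse_power2:
  assumes "n \<ge> 3"
  shows "(radius n (ellipse_point n (u + v) (u - v)) k)\<^sup>2
    = u\<^sup>2 + v\<^sup>2 + 2 * u * v * cos (2 * (2 * pi * real k / real n))"
proof -
  let ?t = "2 * pi * real k / real n"
  have "(radius n (ellipse_point n (u + v) (u - v)) k)\<^sup>2 = ((u + v) * cos ?t)\<^sup>2 + ((u - v) * sin ?t)\<^sup>2"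
    unfolding radius_ellipse[OF assms] ellipse_point_def primroot_power
    by (simp add: power2_norm_eq_inner inner_vec_def sum_2) (simp add: power2_eq_square)
  also have "\<dots> = (u\<^sup>2 + v\<^sup>2) * ((sin ?t)\<^sup>2 + (cos ?t)\<^sup>2) + 2 * u * v * ((cos ?t)\<^sup>2 - (sin ?t)\<^sup>2)"
    by algebra
  also have "\<dots> = u\<^sup>2 + v\<^sup>2 + 2 * u * v * cos (2 * ?t)"
    by (simp only: sin_cos_squared_add cos_double mult_1_right)
  finally show ?thesis .
qed

lemma radius_ellipse_bounds:
  assumes "n \<ge> 3" "0 \<le> v" "v < u"
  shows "u - v \<le> radius n (ellipse_point n (u + v) (u - v)) k" "radius n (ellipse_point n (u + v) (u - v)) k \<le> u + v"
proof -
  let ?r = "radius n (ellipse_point n (u + v) (u - v)) k"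
  have r: "?r \<ge> 0" by (simp add: radius_def)
  have c: "2 * u * v * cos t \<le> 2 * u * v * 1" "2 * u * v * (- 1) \<le> 2 * u * v * cos t" for t
    using assms by (intro mult_left_mono; simp)+
  have "?r\<^sup>2 \<le> (u + v)\<^sup>2" "(u - v)\<^sup>2 \<le> ?r\<^sup>2"
    unfolding radius_ellipse_power2[OF assms(1)] power2_sum power2_diff using c by auto
  then show "u - v \<le> ?r" "?r \<le> u + v"
    using r assms power2_le_imp_le[of ?r "u + v"] power2_le_imp_le[of "u - v" ?r] by auto
qed

text \<open>
  The radii with indices \<open>0\<close> and \<open>1\<close> already differ by an amount of order \<open>v\<close>.
\<close>

lemma radii_variance_ellipse_ge:
  assumes n: "n \<ge> 3" and uv: "0 \<le> v" "v < u"
  shows "(1 - cos (4 * pi / real n))\<^sup>2 / (8 * real n) * v\<^sup>2 \<le> radii_variance n (ellipse_point n (u + v) (u - v))"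
proof -
  let ?r = "radius n (ellipse_point n (u + v) (u - v))"
  define \<kappa> where "\<kappa> = 1 - cos (4 * pi / real n)"
  have \<kappa>: "\<kappa> \<ge> 0" by (simp add: \<kappa>_def)
  have "2 * u * v * \<kappa> = (?r 0)\<^sup>2 - (?r 1)\<^sup>2"
    unfolding radius_ellipse_power2[OF n] by (simp add: \<kappa>_def algebra_simps)
  also have "\<dots> = (?r 0 + ?r 1) * (?r 0 - ?r 1)" by (simp add: power2_eq_square algebra_simps)
  finally have eq: "2 * u * v * \<kappa> = (?r 0 + ?r 1) * (?r 0 - ?r 1)" .
  have r: "0 < ?r 0 + ?r 1" "?r 0 + ?r 1 \<le> 4 * u"
    using radius_ellipse_bounds[OF n uv, of 0] radius_ellipse_bounds[OF n uv, of 1] uv by linarith+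
  have "0 \<le> 2 * u * v * \<kappa>" using uv \<kappa> by simp
  then have d: "?r 0 - ?r 1 \<ge> 0" using eq r(1) by (simp add: zero_le_mult_iff)
  have "2 * u * v * \<kappa> \<le> 4 * u * (?r 0 - ?r 1)"
    unfolding eq using r d by (intro mult_right_mono) auto
  then have "v * \<kappa> / 2 \<le> ?r 0 - ?r 1" using uv by simp
  then have "(v * \<kappa> / 2)\<^sup>2 \<le> (?r 0 - ?r 1)\<^sup>2" using uv \<kappa> by (intro power_mono) auto
  then have "(v * \<kappa> / 2)\<^sup>2 / (2 * real n) \<le> (?r 0 - ?r 1)\<^sup>2 / (2 * real n)"
    by (intro divide_right_mono) auto
  also have "\<dots> \<le> radii_variance n (ellipse_point n (u + v) (u - v))"
    unfolding radii_variance_def using n by (intro family_variance_ge_pair) auto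
  finally show ?thesis by (simp add: \<kappa>_def power_mult_distrib power_divide mult.commute)
qed

lemma normalized_ellipse:
  assumes n: "n \<ge> 3" and e: "0 < e" "e \<le> 1 / 2"
  shows "\<exists>s. 1 / 2 \<le> s \<and> s \<le> 2 \<and> (\<Sum>k<n. radius n (ellipse_point n (s + s * e) (s - s * e)) k) = real n"
proof -
  define R where "R = (\<Sum>k<n. radius n (ellipse_point n (1 + e) (1 - e)) k)"
  have b: "1 / 2 \<le> radius n (ellipse_point n (1 + e) (1 - e)) k" "radius n (ellipse_point n (1 + e) (1 - e)) k \<le> 2" for k
    using radius_ellipse_bounds[OF n, of e 1 k] e by auto
  have "(\<Sum>k<n. 1 / 2) \<le> R" unfolding R_def by (intro sum_mono b)
  moreover have "R \<le> (\<Sum>k<n. 2)" unfolding R_def by (intro sum_mono b)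
  ultimately have R: "real n / 2 \<le> R" "R \<le> 2 * real n" by (simp_all add: mult.commute)
  have n0: "real n > 0" using n by simp
  then have R0: "R > 0" using R by linarith
  define s where "s = real n / R"
  have s: "s > 0" using n0 R0 by (simp add: s_def)
  have "ellipse_point n (s + s * e) (s - s * e) k = s *\<^sub>R ellipse_point n (1 + e) (1 - e) k" for k
    by (simp add: ellipse_point_def vec_eq_iff forall_2 algebra_simps)
  then have "radius n (ellipse_point n (s + s * e) (s - s * e)) k = s * radius n (ellipse_point n (1 + e) (1 - e)) k" for k
    using s by (simp add: radius_ellipse[OF n])
  then have "(\<Sum>k<n. radius n (ellipse_point n (s + s * e) (s - s * e)) k) = s * R"
    by (simp add: R_def sum_distrib_left)
  also have "\<dots> = real n" using R0 by (simp add: s_def)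
  finally have "(\<Sum>k<n. radius n (ellipse_point n (s + s * e) (s - s * e)) k) = real n" .
  moreover have "1 / 2 \<le> s" "s \<le> 2" using R R0 by (simp_all add: s_def field_simps)
  ultimately show ?thesis by blast
qed

text \<open>
  For the stretched polygons with \<open>v = e u\<close>, normalized to mean radius \<open>1\<close>, the assumed inequality becomes
  \<open>a e^2 \<le> b (e^2)^p\<close> with fixed positive \<open>a\<close> and \<open>b\<close>, which fails for small \<open>e\<close> because \<open>p > 1\<close>. The nonnegativity
  of the deficit, used for the monotonicity of the power, comes from the stability inequality.
\<close>

theorem stability_exponent_sharp:
  assumes n: "n \<ge> 3" and p: "p > 1"
    and bound: "\<And>A P. convex_ngon n A P \<Longrightarrow> (\<Sum>i<n. radius n A i) = real n \<Longrightarrow>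
      radii_variance n A + area P * angle_variance n A \<le> C * (deficit n A P) powr p"
    and C: "C > 0"
  shows False
proof -
  define \<kappa> where "\<kappa> = 1 - cos (4 * pi / real n)"
  define a where "a = \<kappa>\<^sup>2 / (32 * real n)"
  define b where "b = C * (32 * (real n)\<^sup>2) powr p"
  have n0: "n > 0" "real n > 0" using n by auto
  have "\<kappa> = 2 * (sin (2 * pi / real n))\<^sup>2"
    using cos_double_sin[of "2 * pi / real n"] by (simp add: \<kappa>_def)
  moreover have "sin (2 * pi / real n) > 0" using n by (intro sin_gt_zero) (auto simp: field_simps)
  ultimately have \<kappa>: "\<kappa> > 0" by simp
  have a: "a > 0" and b: "b > 0" using \<kappa> n0 C by (simp_all add: a_def b_def)
  obtain c where c: "c > 0" "\<And>A P. convex_ngon n A P \<Longrightarrow>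
      radii_variance n A + area P * angle_variance n A \<le> c * deficit n A P"
    using polygonal_stability[OF n] by blast
  have key: "a * e\<^sup>2 \<le> b * (e\<^sup>2) powr p" if e: "0 < e" "e \<le> 1 / 2" for e
  proof -
    obtain s where s: "1 / 2 \<le> s" "s \<le> 2" "(\<Sum>k<n. radius n (ellipse_point n (s + s * e) (s - s * e)) k) = real n"
      using normalized_ellipse[OF n e] by blast
    let ?A = "ellipse_point n (s + s * e) (s - s * e)"
    let ?P = "convex hull (?A ` {..<n})"
    have se: "0 \<le> s * e" "s * e < s" using s e by auto
    have P: "convex_ngon n ?A ?P"
      using se by (intro convex_ngon_ellipse n) auto
    have nonneg: "0 \<le> area ?P * angle_variance n ?A"
      by (simp add: area_def angle_variance_def family_variance_nonneg n0)
    have "a * e\<^sup>2 = \<kappa>\<^sup>2 / (8 * real n) * ((1 / 2)\<^sup>2 * e\<^sup>2)"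
      by (simp add: a_def power2_eq_square)
    also have "\<dots> \<le> \<kappa>\<^sup>2 / (8 * real n) * (s\<^sup>2 * e\<^sup>2)"
      using s by (intro mult_left_mono mult_right_mono power_mono) auto
    also have "\<dots> \<le> radii_variance n ?A"
      using radii_variance_ellipse_ge[OF n se] by (simp add: \<kappa>_def power_mult_distrib)
    finally have lower: "a * e\<^sup>2 \<le> radii_variance n ?A" .
    have "0 \<le> c * deficit n ?A ?P"
      using c(2)[OF P] nonneg lower a zero_le_power2[of e] by (smt (verit) mult_nonneg_nonneg)
    then have d0: "0 \<le> deficit n ?A ?P" using c(1) by (simp add: zero_le_mult_iff)
    have "deficit n ?A ?P \<le> 8 * (real n)\<^sup>2 * (s * e)\<^sup>2"
      using deficit_ellipse_le[OF n, of "s * e" s] se by simp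
    also have "\<dots> = (8 * (real n)\<^sup>2 * e\<^sup>2) * s\<^sup>2" by (simp add: power_mult_distrib)
    also have "\<dots> \<le> (8 * (real n)\<^sup>2 * e\<^sup>2) * 2\<^sup>2"
      using s by (intro mult_left_mono power_mono) auto
    also have "\<dots> = 32 * (real n)\<^sup>2 * e\<^sup>2" by simp
    finally have "deficit n ?A ?P powr p \<le> (32 * (real n)\<^sup>2 * e\<^sup>2) powr p"
      using d0 p by (intro powr_mono2) auto
    then have "C * deficit n ?A ?P powr p \<le> b * (e\<^sup>2) powr p"
      using C by (simp add: b_def powr_mult)
    then show ?thesis using bound[OF P s(3)] nonneg lower by linarith
  qed
  \<comment> \<open>The second term solves \<open>b * x powr (p - 1) = a / 2\<close>; the first one ensures \<open>sqrt x \<le> 1 / 2\<close>.\<close>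
  define x where "x = min (1 / 4) ((a / (2 * b)) powr (1 / (p - 1)))"
  have x: "0 < x" "x \<le> 1 / 4" using a b by (auto simp: x_def)
  have "sqrt x \<le> sqrt ((1 / 2)\<^sup>2)" using x by (intro real_sqrt_le_mono) (simp add: power2_eq_square)
  then have "a * x \<le> b * x powr p"
    using key[of "sqrt x"] x by simp
  also have "\<dots> = b * x powr (p - 1) * x"
    using x by (simp add: powr_diff)
  finally have "a \<le> b * x powr (p - 1)" using x by simp
  also have "\<dots> \<le> b * (((a / (2 * b)) powr (1 / (p - 1))) powr (p - 1))"
    using b x p by (intro mult_left_mono powr_mono2) (auto simp: x_def)
  also have "\<dots> = a / 2" using a b p by (simp add: powr_powr)
  finally show False using a by simp
qed

theorem theorem1p1:
  fixes n :: nat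
  assumes "n \<ge> 3"
  shows "(\<exists>c::real. c > 0 \<and>
           (\<forall>A P. convex_ngon n A P \<longrightarrow>
              c * deficit n A P \<ge> radii_variance n A + area P * angle_variance n A)) \<and>
         (\<forall>p::real. p > 1 \<longrightarrow>
           \<not> (\<exists>C::real. C > 0 \<and>
                (\<forall>A P. convex_ngon n A P \<and> (\<Sum>i<n. radius n A i) = real n \<longrightarrow>
                   radii_variance n A + area P * angle_variance n A
                     \<le> C * (deficit n A P) powr p)))"
  using polygonal_stability[OF assms] stability_exponent_sharp[OF assms] by blast

end
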